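(* Let $\mathcal H=\mathcal H_n$ be uniformly sparse, and let $\mathcal P=N(\mu_n,1)$, $\mathcal Q=N(0,1)$ with $\mu_n>0$. In the hidden weighted graph model, for every fixed $\eta>0$: (i) if $D_{\mathrm{KL}}(\mathcal P\|\mathcal Q)\ge(1+\eta)\log(p_{1M}^{-1})$, then the maximum likelihood estimator achieves almost exact recovery; (ii) if $D_{\mathrm{KL}}(\mathcal P\|\mathcal Q)\le(1-\eta)\log(p_{1M}^{-1})$, then for every fixed $\lambda,\delta\in(0,1)$ no estimator can recover a $\lambda$-fraction of the hidden edges with probability at least $\delta$; that is, for all sufficiently large $n$, every estimator $\hat H$ satisfies $\Pr[|\hat H\cap H^*|\ge\lambda m]<\delta$.
   Context: Hidden weighted graph model. For each positive integer $n$, let $K_n$ be the complete graph on $n$ labelled vertices and $N=\binom n2$ its number of edges. $\mathcal H=\mathcal H_n$ is a nonempty collection of subgraphs of $K_n$ (identified with their edge sets), each having exactly $m=m_n$ edges, where $m\to\infty$ as $n\to\infty$. A graph $H^*$ is drawn uniformly at random from $\mathcal H$; conditionally on $H^*$, the weights $A_e$ of the edges $e$ of $K_n$ are independent, with $A_e\sim\mathcal P$ if $e\in H^*$ and $A_e\sim\mathcal Q$ otherwise. An estimator $\hat H$ is a (possibly randomized) function of $A=(A_e)_e$ (it may depend on $\mathcal P,\mathcal Q,\mathcal H$) with values in $\mathcal H$. $N(\mu,1)$ is the Gaussian distribution with mean $\mu$ and variance 1 (so $D_{\mathrm{KL}}(\mathcal P\|\mathcal Q)=\mu_n^2/2$).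 The maximum likelihood estimator (MLE) outputs a maximizer over $H\in\mathcal H$ of $\sum_{e\in H}\log\frac{d\mathcal P}{d\mathcal Q}(A_e)$. Almost exact recovery: $\hat H$ achieves it if there is a sequence $\delta_n\to0$ with $\Pr[|\hat H\cap H^*|<(1-\delta_n)m]\to0$. $M=|\mathcal H|$ and $p_{1M}=M^{-1/m}$, so $\log M=m\log(p_{1M}^{-1})$; $\log$ is natural, $\log 0=-\infty$. Uniformly sparse: $\log(p_{1M}^{-1})=\omega(1)$ and $$\max_{H_1\in\mathcal H}\ \max_{\ell\in\{0,1,\dots,m\}}\Big\{\log\Pr_{H_2\sim\mathcal H}[|H_1\cap H_2|=\ell]+\ell\log(p_{1M}^{-1})\Big\}=o(\log M),$$ where $H_2\sim\mathcal H$ is uniform on $\mathcal H$. *)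

theory Defs
  imports "HOL-Probability.Probability"
begin

type_synonym graph = "nat set set"

definition complete_edges :: "nat \<Rightarrow> graph" where
  "complete_edges n = {e. e \<subseteq> {1..n} \<and> card e = 2}"

definition weight_space :: "nat \<Rightarrow> (nat set \<Rightarrow> real) measure" where
  "weight_space n = Pi\<^sub>M (complete_edges n) (\<lambda>_. borel)"

definition weight_law ::
    "nat \<Rightarrow> real measure \<Rightarrow> real measure \<Rightarrow> graph \<Rightarrow> (nat set \<Rightarrow> real) measure" where
  "weight_law n P Q H = Pi\<^sub>M (complete_edges n) (\<lambda>e. if e \<in> H then P else Q)"

(* The joint law of the hidden graph H* and the weights A. *)
definition hidden_graph_model ::
    "nat \<Rightarrow> graph set \<Rightarrow> real measure \<Rightarrow> real measure \<Rightarrow> (graph \<times> (nat set \<Rightarrow> real)) measure" where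
  "hidden_graph_model n \<H> P Q =
     uniform_count_measure \<H> \<bind>
       (\<lambda>H. distr (weight_law n P Q H) (count_space \<H> \<Otimes>\<^sub>M weight_space n) (\<lambda>A. (H, A)))"

(* A randomized estimator is a Markov kernel from the weights to \<H>; a deterministic
   estimator f is the kernel (\<lambda>A. return (count_space \<H>) (f A)). *)
definition estimators :: "nat \<Rightarrow> graph set \<Rightarrow> ((nat set \<Rightarrow> real) \<Rightarrow> graph measure) set" where
  "estimators n \<H> = weight_space n \<rightarrow>\<^sub>M prob_algebra (count_space \<H>)"

(* The joint law of H* and the estimator's output, whose conditional law given (H*, A) is K A. *)
definition estimation_law ::
    "nat \<Rightarrow> graph set \<Rightarrow> real measure \<Rightarrow> real measure \<Rightarrow>
      ((nat set \<Rightarrow> real) \<Rightarrow> graph measure) \<Rightarrow> (graph \<times> graph) measure" where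
  "estimation_law n \<H> P Q K =
     hidden_graph_model n \<H> P Q \<bind>
       (\<lambda>(H, A). distr (K A) (count_space \<H> \<Otimes>\<^sub>M count_space \<H>) (\<lambda>H'. (H, H')))"

(* entropy_density b Q P is log_b (dP/dQ): the library puts the reference measure first. *)
definition log_likelihood_ratio :: "real measure \<Rightarrow> real measure \<Rightarrow> real \<Rightarrow> real" where
  "log_likelihood_ratio P Q = entropy_density (exp 1) Q P"

(* D_KL(P || Q); the library's KL_divergence takes its measure arguments in the opposite order. *)
definition D_KL :: "real measure \<Rightarrow> real measure \<Rightarrow> real" where
  "D_KL P Q = KL_divergence (exp 1) Q P"

(* Ties may be broken arbitrarily, possibly at random. *)
definition maximum_likelihood_estimators ::
    "nat \<Rightarrow> graph set \<Rightarrow> real measure \<Rightarrow> real measure \<Rightarrow>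
      ((nat set \<Rightarrow> real) \<Rightarrow> graph measure) set" where
  "maximum_likelihood_estimators n \<H> P Q =
     {K \<in> estimators n \<H>. \<forall>A \<in> space (weight_space n). AE H in K A.
        is_arg_max (\<lambda>H. \<Sum>e\<in>H. log_likelihood_ratio P Q (A e)) (\<lambda>H. H \<in> \<H>) H}"

definition almost_exact_recovery ::
    "(nat \<Rightarrow> graph set) \<Rightarrow> (nat \<Rightarrow> nat) \<Rightarrow> (nat \<Rightarrow> real measure) \<Rightarrow> (nat \<Rightarrow> real measure) \<Rightarrow>
      (nat \<Rightarrow> (nat set \<Rightarrow> real) \<Rightarrow> graph measure) \<Rightarrow> bool" where
  "almost_exact_recovery \<H> m P Q K \<longleftrightarrow>
     (\<exists>\<delta> :: nat \<Rightarrow> real. \<delta> \<longlonglongrightarrow> 0 \<and>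
        (\<lambda>n. \<P>((Hs, Hh) in estimation_law n (\<H> n) (P n) (Q n) (K n).
               real (card (Hh \<inter> Hs)) < (1 - \<delta> n) * real (m n))) \<longlonglongrightarrow> 0)"

definition p1M :: "graph set \<Rightarrow> nat \<Rightarrow> real" where
  "p1M \<H> m = real (card \<H>) powr (- 1 / real m)"

definition ext_ln :: "real \<Rightarrow> ereal" where
  "ext_ln x = (if x = 0 then - \<infinity> else ereal (ln x))"

definition overlap_excess :: "graph set \<Rightarrow> nat \<Rightarrow> ereal" where
  "overlap_excess \<H> m =
     (MAX H1\<in>\<H>. MAX l\<in>{0..m}.
        ext_ln (\<P>(H2 in uniform_count_measure \<H>. card (H1 \<inter> H2) = l))
        + ereal (real l * ln (1 / p1M \<H> m)))"

(* For a nonempty \<H> whose members have m edges each, overlap_excess is finite and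
   nonnegative (take l = m), so real_of_ereal loses nothing. *)
definition uniformly_sparse :: "(nat \<Rightarrow> graph set) \<Rightarrow> (nat \<Rightarrow> nat) \<Rightarrow> bool" where
  "uniformly_sparse \<H> m \<longleftrightarrow>
     filterlim (\<lambda>n. ln (1 / p1M (\<H> n) (m n))) at_top sequentially \<and>
     (\<lambda>n. real_of_ereal (overlap_excess (\<H> n) (m n))) \<in> o(\<lambda>n. ln (real (card (\<H> n))))"

definition gaussian :: "real \<Rightarrow> real measure" where
  "gaussian \<mu> = density lborel (normal_density \<mu> 1)"

end

(* Write Q for the law of the weights when no edge is hidden. Given H* = H, the weights have density
   prod_{e in H} exp(mu A_e - mu^2/2) with respect to Q, so every estimate below is an integral under Q.

   Uniform sparsity bounds the number of members of the family at overlap l with H by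
   M exp(o(m L) - l L), where L = log(1/p1M) and log M = m L. As L -> infinity, also mu is large (i)
   or at most sqrt(2 L) = o(L) (ii), so a deviation of order m of sum_{e in H} |A_e - mu| is negligible
   on the relevant scale.

   (i) If sum_{e in H} |A_e - mu| <= theta delta m mu, then H' with k = |H' - H| >= delta m can beat H
   only if the weights on H' - H sum to (1 - theta) k mu. By Chernoff this has probability at most
   exp(-k (1 - theta)^2 mu^2 / 2), which beats the number exp(k L + o(m L)) of such H'.

   (ii) Let two graphs be drawn independently from the posterior. By Cauchy-Schwarz, an estimator that
   overlaps the first in lam m edges with probability p forces the two to overlap in a positive fraction
   of the edges with probability of order p^2 lam^2. By exchangeability the first may be replaced by H*,
   and then this probability is small: the posterior normalizer exceeds t M with probability 1 - t,
   while the members at overlap l contribute at most M exp(o(m L) - l L + l mu^2 / 2 + O(m mu)). *)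
theory Submission
  imports Defs
begin

section \<open>Gaussian tilts\<close>

text \<open>The density of N(\<mu>,1) with respect to N(0,1). With a parameter other than the signal
  strength it also serves as the exponential tilt of a Chernoff bound.\<close>

definition tilt :: "real \<Rightarrow> real \<Rightarrow> real" where
  "tilt \<mu> x = exp (\<mu> * x - \<mu>\<^sup>2 / 2)"

lemma tilt_pos [simp]: "0 < tilt \<mu> x" and tilt_nonneg [simp]: "0 \<le> tilt \<mu> x"
  by (simp_all add: tilt_def)

lemma measurable_tilt [measurable]: "tilt \<mu> \<in> borel_measurable borel"
  unfolding tilt_def by measurable

lemma sets_gaussian [simp, measurable_cong]: "sets (gaussian \<mu>) = sets borel"
  by (simp add: gaussian_def)

lemma space_gaussian [simp]: "space (gaussian \<mu>) = UNIV"
  by (simp add: gaussian_def)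

lemma prob_space_gaussian: "prob_space (gaussian \<mu>)"
  unfolding gaussian_def by (rule prob_space_normal_density) simp

lemma normal_density_tilt: "normal_density 0 1 x * tilt \<mu> x = normal_density \<mu> 1 x"
  by (simp add: normal_density_def tilt_def exp_add[symmetric] power2_eq_square field_simps)

lemma gaussian_eq_density_tilt: "gaussian \<mu> = density (gaussian 0) (\<lambda>x. ennreal (tilt \<mu> x))"
  unfolding gaussian_def
  by (subst density_density_eq) (simp_all flip: ennreal_mult add: normal_density_tilt)

lemma nn_integral_tilt:
  "f \<in> borel_measurable borel \<Longrightarrow>
    (\<integral>\<^sup>+x. ennreal (tilt \<mu> x) * f x \<partial>gaussian 0) = (\<integral>\<^sup>+x. f x \<partial>gaussian \<mu>)"
  by (subst gaussian_eq_density_tilt[of \<mu>], subst nn_integral_density) simp_all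

lemma nn_integral_tilt_1: "(\<integral>\<^sup>+x. ennreal (tilt \<mu> x) \<partial>gaussian 0) = 1"
  using nn_integral_tilt[of "\<lambda>_. 1" \<mu>] prob_space.emeasure_space_1[OF prob_space_gaussian, of \<mu>]
  by simp

text \<open>The exact value is \<open>sqrt (2 / pi)\<close>. Rounded up to 1, it makes the mean
  total deviation of the hidden weights at most the number of hidden edges, which is what Markov's
  inequality uses later.\<close>

lemma nn_integral_abs_gaussian: "(\<integral>\<^sup>+x. ennreal \<bar>x - \<mu>\<bar> \<partial>gaussian \<mu>) \<le> 1"
proof -
  have "(\<integral>\<^sup>+x. ennreal \<bar>x - \<mu>\<bar> \<partial>gaussian \<mu>) =
      (\<integral>\<^sup>+x. ennreal (normal_density \<mu> 1 x * \<bar>x - \<mu>\<bar>) \<partial>lborel)"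
    unfolding gaussian_def by (subst nn_integral_density) (simp_all add: ennreal_mult')
  also have "\<dots> = ennreal (\<integral>x. normal_density \<mu> 1 x * \<bar>x - \<mu>\<bar> \<partial>lborel)"
    using integrable_normal_moment_abs[of 1 \<mu> 1] by (intro nn_integral_eq_integral) simp_all
  also have "\<dots> = ennreal (sqrt (2 / pi))"
    using integral_normal_moment_abs_odd[of 1 \<mu> 0] by simp
  also have "\<dots> \<le> 1"
    using pi_ge_two by simp
  finally show ?thesis .
qed

text \<open>A Radon-Nikodym derivative is determined only up to null sets, so the explicit log ratio
  is available almost everywhere, and the pointwise analysis of maximum likelihood estimators has to
  exclude a null set.\<close>

lemma AE_log_likelihood_ratio_gaussian:
  "AE x in gaussian 0. log_likelihood_ratio (gaussian \<mu>) (gaussian 0) x = \<mu> * x - \<mu>\<^sup>2 / 2"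
proof -
  interpret G: prob_space "gaussian 0" by (rule prob_space_gaussian)
  have "AE x in gaussian 0. ennreal (tilt \<mu> x) = RN_deriv (gaussian 0) (gaussian \<mu>) x"
    by (rule G.RN_deriv_unique) (simp_all flip: gaussian_eq_density_tilt)
  then show ?thesis
  proof eventually_elim
    case (elim x)
    have "enn2real (RN_deriv (gaussian 0) (gaussian \<mu>) x) = tilt \<mu> x"
      by (simp flip: elim)
    then show ?case
      by (simp add: log_likelihood_ratio_def entropy_density_def log_def tilt_def)
  qed
qed

text \<open>The log density ratio is the affine function \<mu> x - \<mu>^2 / 2, and \<open>x\<close>
  has mean \<mu> under N(\<mu>,1).\<close>

lemma D_KL_gaussian: "D_KL (gaussian \<mu>) (gaussian 0) = \<mu>\<^sup>2 / 2"
proof -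
  have "D_KL (gaussian \<mu>) (gaussian 0) =
      (\<integral>x. normal_density \<mu> 1 x * log (exp 1) (normal_density \<mu> 1 x / normal_density 0 1 x) \<partial>lborel)"
    unfolding D_KL_def gaussian_def
    by (rule lborel.KL_density_density) (auto simp: normal_density_pos[THEN less_imp_neq, symmetric])
  also have "\<dots> = (\<integral>x. \<mu> * (normal_density \<mu> 1 x * x) - \<mu>\<^sup>2 / 2 * normal_density \<mu> 1 x \<partial>lborel)"
  proof (rule Bochner_Integration.integral_cong[OF refl])
    fix x :: real
    have "normal_density 0 1 x \<noteq> 0"
      by (simp add: normal_density_def)
    then have "normal_density \<mu> 1 x / normal_density 0 1 x = tilt \<mu> x"
      by (simp add: normal_density_tilt[of x \<mu>, symmetric])
    then show "normal_density \<mu> 1 x * log (exp 1) (normal_density \<mu> 1 x / normal_density 0 1 x) =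
        \<mu> * (normal_density \<mu> 1 x * x) - \<mu>\<^sup>2 / 2 * normal_density \<mu> 1 x"
      by (simp add: log_def tilt_def algebra_simps)
  qed
  also have "\<dots> = \<mu>\<^sup>2 / 2"
    by (subst Bochner_Integration.integral_diff)
       (simp_all add: integrable_normal_moment_nz_1 integral_normal_moment_nz_1 power2_eq_square)
  finally show ?thesis .
qed

section \<open>Likelihood ratios of the weight laws\<close>

abbreviation null_law :: "nat \<Rightarrow> (nat set \<Rightarrow> real) measure" where
  "null_law n \<equiv> Pi\<^sub>M (complete_edges n) (\<lambda>_. gaussian 0)"

lemma finite_complete_edges [simp, intro]: "finite (complete_edges n)"
  by (rule finite_subset[of _ "Pow {1..n}"]) (auto simp: complete_edges_def)

lemma sets_null_law [measurable_cong]: "sets (null_law n) = sets (weight_space n)"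
  unfolding weight_space_def by (intro sets_PiM_cong) simp_all

lemma sets_weight_law:
  "sets P = sets borel \<Longrightarrow> sets Q = sets borel \<Longrightarrow> sets (weight_law n P Q H) = sets (weight_space n)"
  unfolding weight_space_def weight_law_def by (intro sets_PiM_cong) simp_all

lemma prob_space_weight_law:
  "prob_space P \<Longrightarrow> prob_space Q \<Longrightarrow> prob_space (weight_law n P Q H)"
  unfolding weight_law_def by (rule prob_space_PiM) simp

lemma measurable_weight [measurable]:
  "e \<in> complete_edges n \<Longrightarrow> (\<lambda>A. A e) \<in> borel_measurable (weight_space n)"
  unfolding weight_space_def by (rule measurable_component_singleton)

lemma AE_log_likelihood_ratio:
  "AE A in null_law n. \<forall>e\<in>complete_edges n.
    log_likelihood_ratio (gaussian \<mu>) (gaussian 0) (A e) = \<mu> * A e - \<mu>\<^sup>2 / 2"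
  by (intro eventually_ball_finite ballI AE_PiM_component prob_space_gaussian
      AE_log_likelihood_ratio_gaussian finite_complete_edges)

lemma nn_integral_null_law_prod:
  assumes "\<And>e. e \<in> complete_edges n \<Longrightarrow> f e \<in> borel_measurable borel"
  shows "(\<integral>\<^sup>+A. (\<Prod>e\<in>complete_edges n. f e (A e)) \<partial>null_law n) =
    (\<Prod>e\<in>complete_edges n. \<integral>\<^sup>+x. f e x \<partial>gaussian 0)"
proof -
  interpret product_sigma_finite "\<lambda>_::nat set. gaussian 0"
    unfolding product_sigma_finite_def
    by (auto intro: prob_space_gaussian prob_space_imp_sigma_finite)
  show ?thesis
    by (rule product_nn_integral_prod) (auto simp: measurable_cong_sets[OF sets_gaussian refl] assms)
qed

text \<open>\<open>S\<close> ranges over arbitrary edge sets. For the hidden graph and the true mean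
  this is the density of the weights against \<open>null_law\<close>; on a difference
  \<open>H' - H\<close>, possibly with another parameter, it is a Chernoff factor.\<close>

definition likelihood :: "real \<Rightarrow> graph \<Rightarrow> (nat set \<Rightarrow> real) \<Rightarrow> real" where
  "likelihood \<mu> S A = (\<Prod>e\<in>S. tilt \<mu> (A e))"

lemma likelihood_pos [simp]: "0 < likelihood \<mu> S A" and likelihood_nonneg [simp]: "0 \<le> likelihood \<mu> S A"
  by (simp_all add: likelihood_def prod_pos prod_nonneg)

lemma likelihood_eq_exp:
  "finite S \<Longrightarrow> likelihood \<mu> S A = exp (\<mu> * (\<Sum>e\<in>S. A e) - real (card S) * \<mu>\<^sup>2 / 2)"
  by (simp add: likelihood_def tilt_def flip: exp_sum) (simp add: sum_subtractf sum_distrib_left)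

lemma measurable_likelihood [measurable]:
  "S \<subseteq> complete_edges n \<Longrightarrow> likelihood \<mu> S \<in> borel_measurable (weight_space n)"
  unfolding likelihood_def by (intro borel_measurable_prod) (auto intro!: measurable_compose[OF measurable_weight measurable_tilt])

lemma prod_on_subset:
  "finite E \<Longrightarrow> S \<subseteq> E \<Longrightarrow> (\<Prod>e\<in>E. if e \<in> S then f e else (1::'a::comm_monoid_mult)) = prod f S"
  by (simp add: prod.If_cases Int_absorb1 Int_commute)

lemma ennreal_likelihood:
  assumes "S \<subseteq> complete_edges n"
  shows "ennreal (likelihood \<mu> S A) = (\<Prod>e\<in>complete_edges n. if e \<in> S then ennreal (tilt \<mu> (A e)) else 1)"
  by (simp add: likelihood_def prod_on_subset[OF _ assms] prod_ennreal)

text \<open>With factors 1 on the other edges, the integrand is a product over all edges of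
  functions of single weights. By disjointness no edge carries two tilts, so each one-dimensional
  integral is 1. Hence a tilt on \<open>T\<close> still has mean 1 when the edges of
  \<open>S\<close> are hidden.\<close>

lemma nn_integral_likelihood_mult:
  assumes "S \<subseteq> complete_edges n" "T \<subseteq> complete_edges n" "S \<inter> T = {}"
  shows "(\<integral>\<^sup>+A. ennreal (likelihood \<mu> S A * likelihood s T A) \<partial>null_law n) = 1"
proof -
  let ?f = "\<lambda>e x. (if e \<in> S then ennreal (tilt \<mu> x) else 1) * (if e \<in> T then ennreal (tilt s x) else 1)"
  have "(\<integral>\<^sup>+A. ennreal (likelihood \<mu> S A * likelihood s T A) \<partial>null_law n) =
      (\<integral>\<^sup>+A. (\<Prod>e\<in>complete_edges n. ?f e (A e)) \<partial>null_law n)"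
    by (simp add: ennreal_mult ennreal_likelihood[OF assms(1)] ennreal_likelihood[OF assms(2)] prod.distrib)
  also have "\<dots> = (\<Prod>e\<in>complete_edges n. \<integral>\<^sup>+x. ?f e x \<partial>gaussian 0)"
    by (rule nn_integral_null_law_prod) simp
  also have "\<dots> = (\<Prod>e\<in>complete_edges n. 1)"
  proof (rule prod.cong[OF refl])
    fix e
    show "(\<integral>\<^sup>+x. ?f e x \<partial>gaussian 0) = 1"
      using assms(3) prob_space.emeasure_space_1[OF prob_space_gaussian, of 0]
      by (cases "e \<in> S"; cases "e \<in> T") (auto simp: nn_integral_tilt_1)
  qed
  finally show ?thesis by simp
qed

text \<open>Weighting by the likelihood turns the law of \<open>A d\<close> into N(\<mu>,1), whose
  mean absolute deviation is at most 1; every other edge integrates to 1.\<close>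

lemma nn_integral_likelihood_abs:
  assumes "S \<subseteq> complete_edges n" "d \<in> S"
  shows "(\<integral>\<^sup>+A. ennreal (likelihood \<mu> S A * \<bar>A d - \<mu>\<bar>) \<partial>null_law n) \<le> 1"
proof -
  let ?f = "\<lambda>e x. (if e \<in> S then ennreal (tilt \<mu> x) else 1) * (if e \<in> {d} then ennreal \<bar>x - \<mu>\<bar> else 1)"
  have d: "{d} \<subseteq> complete_edges n" using assms by auto
  have "(\<integral>\<^sup>+A. ennreal (likelihood \<mu> S A * \<bar>A d - \<mu>\<bar>) \<partial>null_law n) =
      (\<integral>\<^sup>+A. (\<Prod>e\<in>complete_edges n. ?f e (A e)) \<partial>null_law n)"
    by (simp add: ennreal_mult ennreal_likelihood[OF assms(1)] prod.distrib prod_on_subset[OF _ d]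
        del: insert_iff singleton_iff)
  also have "\<dots> = (\<Prod>e\<in>complete_edges n. \<integral>\<^sup>+x. ?f e x \<partial>gaussian 0)"
    by (rule nn_integral_null_law_prod) simp
  also have "\<dots> \<le> (\<Prod>e\<in>complete_edges n. 1)"
  proof (rule prod_mono_ennreal)
    fix e
    show "(\<integral>\<^sup>+x. ?f e x \<partial>gaussian 0) \<le> 1"
      using assms(2) prob_space.emeasure_space_1[OF prob_space_gaussian, of 0]
        nn_integral_abs_gaussian[of \<mu>] nn_integral_tilt[of "\<lambda>x. ennreal \<bar>x - \<mu>\<bar>" \<mu>]
      by (cases "e \<in> S"; cases "e = d") (auto simp: nn_integral_tilt_1)
  qed
  finally show ?thesis by simp
qed

text \<open>Product measures are determined by their values on boxes. There both the density and the
  indicator factor over the edges, and the tilt turns N(0,1) into N(\<mu>,1) exactly on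
  \<open>H\<close>.\<close>

lemma weight_law_gaussian:
  assumes "H \<subseteq> complete_edges n"
  shows "weight_law n (gaussian \<mu>) (gaussian 0) H = density (null_law n) (\<lambda>A. ennreal (likelihood \<mu> H A))"
proof -
  let ?E = "complete_edges n" and ?G = "\<lambda>e. if e \<in> H then gaussian \<mu> else gaussian 0"
  interpret product_sigma_finite ?G
    unfolding product_sigma_finite_def
    by (auto intro: prob_space_gaussian prob_space_imp_sigma_finite)
  have "density (null_law n) (\<lambda>A. ennreal (likelihood \<mu> H A)) = Pi\<^sub>M ?E ?G"
  proof (rule PiM_eqI)
    show "sets (density (null_law n) (\<lambda>A. ennreal (likelihood \<mu> H A))) = sets (Pi\<^sub>M ?E ?G)"
      unfolding sets_density by (intro sets_PiM_cong) simp_all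
    fix X :: "nat set \<Rightarrow> real set"
    assume "\<And>e. e \<in> ?E \<Longrightarrow> X e \<in> sets (?G e)"
    then have X: "X e \<in> sets borel" if "e \<in> ?E" for e
      using that by (cases "e \<in> H") force+
    let ?f = "\<lambda>e x. (if e \<in> H then ennreal (tilt \<mu> x) else 1) * indicator (X e) x"
    have XE: "Pi\<^sub>E ?E X \<in> sets (null_law n)"
      using X by (intro sets_PiM_I_finite) auto
    have "emeasure (density (null_law n) (\<lambda>A. ennreal (likelihood \<mu> H A))) (Pi\<^sub>E ?E X) =
        (\<integral>\<^sup>+A. ennreal (likelihood \<mu> H A) * indicator (Pi\<^sub>E ?E X) A \<partial>null_law n)"
      by (rule emeasure_density[OF _ XE])
         (intro measurable_compose[OF _ measurable_ennreal], simp add: measurable_cong_sets[OF sets_null_law refl] measurable_likelihood assms)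
    also have "\<dots> = (\<integral>\<^sup>+A. (\<Prod>e\<in>?E. ?f e (A e)) \<partial>null_law n)"
    proof (rule nn_integral_cong)
      fix A assume "A \<in> space (null_law n)"
      then have "indicator (Pi\<^sub>E ?E X) A = (\<Prod>e\<in>?E. indicator (X e) (A e) :: ennreal)"
        by (cases "A \<in> Pi\<^sub>E ?E X") (auto simp: space_PiM PiE_iff intro!: prod.neutral[symmetric] bexI)
      then show "ennreal (likelihood \<mu> H A) * indicator (Pi\<^sub>E ?E X) A = (\<Prod>e\<in>?E. ?f e (A e))"
        by (simp add: ennreal_likelihood[OF assms] prod.distrib)
    qed
    also have "\<dots> = (\<Prod>e\<in>?E. \<integral>\<^sup>+x. ?f e x \<partial>gaussian 0)"
      by (rule nn_integral_null_law_prod)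
         (intro borel_measurable_times_ennreal borel_measurable_indicator X, auto)
    also have "\<dots> = (\<Prod>e\<in>?E. emeasure (?G e) (X e))"
      by (rule prod.cong) (use X in \<open>auto simp: nn_integral_tilt\<close>)
    finally show "emeasure (density (null_law n) (\<lambda>A. ennreal (likelihood \<mu> H A))) (Pi\<^sub>E ?E X) =
      (\<Prod>e\<in>?E. emeasure (?G e) (X e))" .
  qed simp
  then show ?thesis by (simp add: weight_law_def)
qed

lemma has_bochner_integral_likelihood_mult:
  assumes "S \<subseteq> complete_edges n" "T \<subseteq> complete_edges n" "S \<inter> T = {}"
  shows "has_bochner_integral (null_law n) (\<lambda>A. likelihood \<mu> S A * likelihood s T A) 1"
proof (rule has_bochner_integral_nn_integral)
  show "(\<lambda>A. likelihood \<mu> S A * likelihood s T A) \<in> borel_measurable (null_law n)"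
    using assms by measurable
qed (use nn_integral_likelihood_mult[OF assms] in simp_all)

lemma has_bochner_integral_likelihood:
  "S \<subseteq> complete_edges n \<Longrightarrow> has_bochner_integral (null_law n) (likelihood \<mu> S) 1"
  using has_bochner_integral_likelihood_mult[of S n "{}" \<mu> 0] by (simp add: likelihood_def[of 0])

lemma integrable_likelihood_abs:
  assumes "S \<subseteq> complete_edges n" "e \<in> S"
  shows "integrable (null_law n) (\<lambda>A. likelihood \<mu> S A * \<bar>A e - \<mu>\<bar>)" (is ?I)
    and "(\<integral>A. likelihood \<mu> S A * \<bar>A e - \<mu>\<bar> \<partial>null_law n) \<le> 1" (is ?L)
proof -
  have e: "e \<in> complete_edges n" using assms by auto
  have [measurable]: "(\<lambda>A. likelihood \<mu> S A * \<bar>A e - \<mu>\<bar>) \<in> borel_measurable (null_law n)"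
    using assms e by measurable
  note le1 = nn_integral_likelihood_abs[OF assms, of \<mu>]
  show I: ?I
    by (rule integrableI_nonneg) (use le_less_trans[OF le1] in simp_all)
  have "ennreal (\<integral>A. likelihood \<mu> S A * \<bar>A e - \<mu>\<bar> \<partial>null_law n) \<le> 1"
    using le1 by (subst nn_integral_eq_integral[OF I, symmetric]) simp_all
  then show ?L by (simp add: ennreal_le_1)
qed

section \<open>Error probabilities of estimators\<close>

text \<open>Integrating the kernels in turn leaves an average, over hidden graphs, of the expected
  mass that the estimator gives to the event. Randomization enters the later arguments only through
  this mass.\<close>

lemma estimation_law_emeasure:
  assumes fin: "finite \<H>" and ne: "\<H> \<noteq> {}" and K: "K \<in> estimators n \<H>"
    and P: "prob_space P" "sets P = sets borel" and Q: "prob_space Q" "sets Q = sets borel"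
  shows "emeasure (estimation_law n \<H> P Q K)
      {(Hs, Hh) \<in> space (estimation_law n \<H> P Q K). R Hs Hh} =
    (\<Sum>H\<in>\<H>. \<integral>\<^sup>+A. emeasure (K A) {H' \<in> \<H>. R H H'} \<partial>weight_law n P Q H) / card \<H>"
proof -
  let ?C = "count_space \<H>" and ?W = "weight_space n" and ?U = "uniform_count_measure \<H>"
  let ?L = "weight_law n P Q"
  let ?D = "\<lambda>H. distr (?L H) (?C \<Otimes>\<^sub>M ?W) (\<lambda>A. (H, A))"
  let ?T = "\<lambda>(H, A). distr (K A) (?C \<Otimes>\<^sub>M ?C) (\<lambda>H'. (H, H'))"
  have K': "K \<in> ?W \<rightarrow>\<^sub>M prob_algebra ?C"
    using K by (simp add: estimators_def)
  have KA: "sets (K A) = Pow \<H>" "space (K A) = \<H>" "prob_space (K A)" if "A \<in> space ?W" for A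
    using measurable_space[OF K' that] sets_eq_imp_space_eq[of "K A" ?C] by (auto simp: space_prob_algebra)
  have setsL: "sets (?L H) = sets ?W" and probL: "prob_space (?L H)" for H
    by (simp_all add: sets_weight_law prob_space_weight_law P Q)
  have spL: "space (?L H) = space ?W" for H
    by (rule sets_eq_imp_space_eq[OF setsL])
  have neU: "space ?U \<noteq> {}" using ne by (simp add: space_uniform_count_measure)
  have pairm: "(\<lambda>A. (H, A)) \<in> ?L H \<rightarrow>\<^sub>M ?C \<Otimes>\<^sub>M ?W" if "H \<in> \<H>" for H
    using that by (intro measurable_Pair) (auto simp: measurable_cong_sets[OF setsL refl])
  have D: "?D \<in> ?U \<rightarrow>\<^sub>M subprob_algebra (?C \<Otimes>\<^sub>M ?W)"
  proof -
    have "?D H \<in> space (subprob_algebra (?C \<Otimes>\<^sub>M ?W))" if "H \<in> \<H>" for H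
      using prob_space.prob_space_distr[OF probL pairm[OF that]]
      by (auto simp: space_subprob_algebra intro: prob_space_imp_subprob_space)
    then have "?D \<in> ?C \<rightarrow>\<^sub>M subprob_algebra (?C \<Otimes>\<^sub>M ?W)"
      by simp
    then show ?thesis
      by (simp add: measurable_cong_sets[OF sets_uniform_count_measure_count_space refl])
  qed
  have T: "?T \<in> ?C \<Otimes>\<^sub>M ?W \<rightarrow>\<^sub>M subprob_algebra (?C \<Otimes>\<^sub>M ?C)"
  proof -
    have "(\<lambda>x. distr (K (snd x)) (?C \<Otimes>\<^sub>M ?C) (\<lambda>H'. (fst x, H'))) \<in> ?C \<Otimes>\<^sub>M ?W \<rightarrow>\<^sub>M subprob_algebra (?C \<Otimes>\<^sub>M ?C)"
      by (rule measurable_distr2[where M="?C"])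
         (auto intro!: measurable_compose[OF measurable_snd measurable_prob_algebraD[OF K']])
    then show ?thesis by (simp add: case_prod_beta')
  qed
  have HGM: "hidden_graph_model n \<H> P Q = ?U \<bind> ?D"
    by (simp add: hidden_graph_model_def)
  have setsM: "sets (?U \<bind> ?D) = sets (?C \<Otimes>\<^sub>M ?W)"
    by (rule sets_bind[OF _ neU]) simp
  have T': "?T \<in> (?U \<bind> ?D) \<rightarrow>\<^sub>M subprob_algebra (?C \<Otimes>\<^sub>M ?C)"
    using T by (simp add: measurable_cong_sets[OF setsM refl])
  have neM: "space (?U \<bind> ?D) \<noteq> {}"
    using ne unfolding sets_eq_imp_space_eq[OF setsM]
    by (auto simp: space_pair_measure weight_space_def space_PiM PiE_eq_empty_iff)
  have setsE: "sets (estimation_law n \<H> P Q K) = sets (?C \<Otimes>\<^sub>M ?C)"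
    unfolding estimation_law_def HGM by (rule sets_bind[OF sets_kernel[OF T'] neM])
  \<comment> \<open>Finiteness makes the product sigma-algebra discrete, so that every relation
    \<open>R\<close> defines an event.\<close>
  have CC: "?C \<Otimes>\<^sub>M ?C = count_space (\<H> \<times> \<H>)"
    using fin by (intro pair_measure_countable) (auto intro: countable_finite)
  define X where "X = {x \<in> \<H> \<times> \<H>. case x of (Hs, Hh) \<Rightarrow> R Hs Hh}"
  have X: "X \<in> sets (?C \<Otimes>\<^sub>M ?C)" unfolding X_def CC by auto
  have Xeq: "{(Hs, Hh) \<in> space (estimation_law n \<H> P Q K). R Hs Hh} = X"
    unfolding X_def sets_eq_imp_space_eq[OF setsE] by (auto simp: CC)
  have mT: "(\<lambda>x. emeasure (?T x) X) \<in> borel_measurable (?C \<Otimes>\<^sub>M ?W)"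
    by (rule measurable_compose[OF T measurable_emeasure_subprob_algebra[OF X]])
  have "emeasure (estimation_law n \<H> P Q K) X = (\<integral>\<^sup>+x. emeasure (?T x) X \<partial>(?U \<bind> ?D))"
    unfolding estimation_law_def HGM by (rule emeasure_bind[OF neM T' X])
  also have "\<dots> = (\<integral>\<^sup>+H. \<integral>\<^sup>+x. emeasure (?T x) X \<partial>?D H \<partial>?U)"
    by (rule nn_integral_bind[OF mT D])
  also have "\<dots> = (\<integral>\<^sup>+H. \<integral>\<^sup>+A. emeasure (K A) {H' \<in> \<H>. R H H'} \<partial>?L H \<partial>?U)"
  proof (rule nn_integral_cong)
    fix H assume "H \<in> space ?U"
    then have H: "H \<in> \<H>" by (simp add: space_uniform_count_measure)
    have "(\<integral>\<^sup>+x. emeasure (?T x) X \<partial>?D H) = (\<integral>\<^sup>+A. emeasure (?T (H, A)) X \<partial>?L H)"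
      by (rule nn_integral_distr[OF pairm[OF H]]) (use mT in simp)
    also have "\<dots> = (\<integral>\<^sup>+A. emeasure (K A) {H' \<in> \<H>. R H H'} \<partial>?L H)"
    proof (rule nn_integral_cong)
      fix A assume "A \<in> space (?L H)"
      then have A: "A \<in> space ?W" by (simp add: spL)
      have m: "(\<lambda>H'. (H, H')) \<in> K A \<rightarrow>\<^sub>M ?C \<Otimes>\<^sub>M ?C"
        using H KA(1,2)[OF A] by (auto simp: CC measurable_def)
      have "emeasure (?T (H, A)) X = emeasure (K A) ((\<lambda>H'. (H, H')) -` X \<inter> space (K A))"
        by (simp add: emeasure_distr[OF m X])
      also have "(\<lambda>H'. (H, H')) -` X \<inter> space (K A) = {H' \<in> \<H>. R H H'}"
        using H KA(2)[OF A] by (auto simp: X_def)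
      finally show "emeasure (?T (H, A)) X = emeasure (K A) {H' \<in> \<H>. R H H'}" .
    qed
    finally show "(\<integral>\<^sup>+x. emeasure (?T x) X \<partial>?D H) = (\<integral>\<^sup>+A. emeasure (K A) {H' \<in> \<H>. R H H'} \<partial>?L H)" .
  qed
  also have "\<dots> = (\<Sum>H\<in>\<H>. (\<integral>\<^sup>+A. emeasure (K A) {H' \<in> \<H>. R H H'} \<partial>?L H) / card \<H>)"
    unfolding uniform_count_measure_def
    using fin ne by (subst nn_integral_point_measure_finite)
       (simp_all add: divide_ennreal_def  inverse_ennreal card_gt_0_iff divide_inverse mult.commute ennreal_of_nat_eq_real_of_nat)
  finally show ?thesis
    unfolding Xeq by (simp add: divide_ennreal_def sum_distrib_right)
qed

section \<open>Families with bounded overlap counts\<close>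

text \<open>Draw \<open>H\<close> and \<open>H'\<close> independently with law \<open>p\<close>, and
  let \<open>a e\<close> be the probability that \<open>H\<close> contains \<open>e\<close>. By
  Markov, lam m P(|F \<inter> H| \<ge> lam m) is at most the sum of \<open>a\<close> over
  \<open>F\<close>. By Cauchy-Schwarz its square is at most m times the sum of squares, which is the
  expected size of F \<inter> H \<inter> H'. This size is at most lam' m, unless \<open>H\<close>
  and \<open>H'\<close> overlap in lam' m edges, and never exceeds m.\<close>

lemma overlap_second_moment:
  fixes p :: "'a set \<Rightarrow> real" and lam lam' :: real
  assumes fin: "finite \<H>" and p: "\<And>H. H \<in> \<H> \<Longrightarrow> 0 \<le> p H" and sum1: "sum p \<H> = 1"
    and card: "\<And>H. H \<in> \<H> \<Longrightarrow> finite H \<and> card H = m" and F: "finite F" "card F = m" and m: "0 < m"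
    and lam: "0 \<le> lam" and lam': "0 \<le> lam'"
  shows "(lam * (\<Sum>H | H \<in> \<H> \<and> lam * m \<le> card (F \<inter> H). p H))\<^sup>2 \<le>
    lam' + (\<Sum>H\<in>\<H>. p H * (\<Sum>H' | H' \<in> \<H> \<and> lam' * m \<le> card (H \<inter> H'). p H'))"
proof -
  define a where "a e = (\<Sum>H\<in>\<H>. p H * of_bool (e \<in> H))" for e
  have sumF: "(\<Sum>e\<in>F. of_bool (e \<in> H) :: real) = card (F \<inter> H)" for H
    using F by (simp add: Int_def)
  have "lam * m * (\<Sum>H | H \<in> \<H> \<and> lam * m \<le> card (F \<inter> H). p H) =
      (\<Sum>H | H \<in> \<H> \<and> lam * m \<le> card (F \<inter> H). p H * (lam * m))"
    by (simp add: sum_distrib_left mult.commute)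
  also have "\<dots> \<le> (\<Sum>H | H \<in> \<H> \<and> lam * m \<le> card (F \<inter> H). p H * card (F \<inter> H))"
    using p by (intro sum_mono mult_left_mono) auto
  also have "\<dots> \<le> (\<Sum>H\<in>\<H>. p H * card (F \<inter> H))"
    using p fin by (intro sum_mono2) auto
  also have "\<dots> = (\<Sum>e\<in>F. a e)"
    unfolding a_def by (subst sum.swap) (simp add: sumF flip: sum_distrib_left)
  finally have 1: "m * (lam * (\<Sum>H | H \<in> \<H> \<and> lam * m \<le> card (F \<inter> H). p H)) \<le> (\<Sum>e\<in>F. a e)"
    by (simp add: algebra_simps)
  have nn: "0 \<le> m * (lam * (\<Sum>H | H \<in> \<H> \<and> lam * m \<le> card (F \<inter> H). p H))"
    using lam p by (intro mult_nonneg_nonneg sum_nonneg) auto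
  have "m\<^sup>2 * (lam * (\<Sum>H | H \<in> \<H> \<and> lam * m \<le> card (F \<inter> H). p H))\<^sup>2 \<le> (\<Sum>e\<in>F. a e)\<^sup>2"
    using power_mono[OF 1 nn, of 2] by (simp add: power_mult_distrib)
  also have "\<dots> \<le> m * (\<Sum>e\<in>F. (a e)\<^sup>2)"
    using sum_squared_le_sum_of_squares[of a F] F m by (simp add: mult.commute)
  \<comment> \<open>Squaring a probability amounts to drawing a second independent set.\<close>
  also have "(\<Sum>e\<in>F. (a e)\<^sup>2) = (\<Sum>H\<in>\<H>. \<Sum>H'\<in>\<H>. p H * p H' * card (F \<inter> H \<inter> H'))"
  proof -
    have "(\<Sum>e\<in>F. (a e)\<^sup>2) = (\<Sum>e\<in>F. \<Sum>H\<in>\<H>. \<Sum>H'\<in>\<H>. p H * p H' * of_bool (e \<in> H \<inter> H'))"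
      unfolding a_def power2_eq_square sum_product
      by (intro sum.cong refl) (auto simp: of_bool_def)
    also have "\<dots> = (\<Sum>H\<in>\<H>. \<Sum>H'\<in>\<H>. p H * p H' * (\<Sum>e\<in>F. of_bool (e \<in> H \<inter> H')))"
      by (subst sum.swap, rule sum.cong[OF refl], subst sum.swap) (simp only: sum_distrib_left)
    finally show ?thesis by (simp only: sumF Int_assoc)
  qed
  also have "\<dots> \<le> (\<Sum>H\<in>\<H>. \<Sum>H'\<in>\<H>. p H * p H' * (m * lam' + m * of_bool (lam' * m \<le> card (H \<inter> H'))))"
  proof (intro sum_mono mult_left_mono)
    fix H H' assume H: "H \<in> \<H>" "H' \<in> \<H>"
    have "card (F \<inter> H \<inter> H') \<le> card (H \<inter> H')" "card (H \<inter> H') \<le> m"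
      using card[OF H(1)] by (auto intro!: card_mono simp flip: card)
    then show "real (card (F \<inter> H \<inter> H')) \<le> m * lam' + m * of_bool (lam' * m \<le> card (H \<inter> H'))"
      using lam' by (cases "lam' * m \<le> card (H \<inter> H')") (auto simp: mult.commute add_increasing intro: order_trans)
  qed (use p in auto)
  also have "\<dots> = m * (lam' * (\<Sum>H\<in>\<H>. \<Sum>H'\<in>\<H>. p H * p H') +
      (\<Sum>H\<in>\<H>. \<Sum>H'\<in>\<H>. p H * p H' * of_bool (lam' * m \<le> card (H \<inter> H'))))"
    by (simp add: sum_distrib_left sum.distrib distrib_left mult_ac)
  also have "(\<Sum>H\<in>\<H>. \<Sum>H'\<in>\<H>. p H * p H') = 1"
    by (simp add: sum1 flip: sum_product)
  also have "(\<Sum>H\<in>\<H>. \<Sum>H'\<in>\<H>. p H * p H' * of_bool (lam' * m \<le> card (H \<inter> H'))) =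
      (\<Sum>H\<in>\<H>. p H * (\<Sum>H' | H' \<in> \<H> \<and> lam' * m \<le> card (H \<inter> H'). p H'))"
    using fin by (simp add: sum_distrib_left sum.inter_filter of_bool_def if_distrib mult.assoc cong: if_cong)
  finally have "real (m\<^sup>2) * (lam * (\<Sum>H | H \<in> \<H> \<and> lam * m \<le> card (F \<inter> H). p H))\<^sup>2 \<le>
      real (m\<^sup>2) * (lam' + (\<Sum>H\<in>\<H>. p H * (\<Sum>H' | H' \<in> \<H> \<and> lam' * m \<le> card (H \<inter> H'). p H')))"
    using m by (simp add: power2_eq_square mult.assoc mult_left_mono)
  then show ?thesis using m by simp
qed

text \<open>Uniform sparsity at a single \<open>n\<close>: \<open>L\<close> stands for log(1/p1M)
  and the slack \<open>x\<close> for the overlap excess. Keeping \<open>x\<close> explicit makes the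
  probability bounds nonasymptotic; that it is o(m L) enters only in the final limits.\<close>

locale overlap_bounded =
  fixes n :: nat and \<H> :: "graph set" and m :: nat and L x :: real
  assumes nonempty: "\<H> \<noteq> {}"
    and subgraph: "H \<in> \<H> \<Longrightarrow> H \<subseteq> complete_edges n"
    and card_edges: "H \<in> \<H> \<Longrightarrow> card H = m"
    and m_pos: "0 < m"
    and L_nonneg: "0 \<le> L"
    and card_overlap: "H \<in> \<H> \<Longrightarrow> l \<le> m \<Longrightarrow>
      card {H' \<in> \<H>. card (H \<inter> H') = l} \<le> card \<H> * exp (x - l * L)"
begin

lemma finite_family: "finite \<H>"
  by (rule finite_subset[of _ "Pow (complete_edges n)"]) (use subgraph in auto)

lemma finite_member: "H \<in> \<H> \<Longrightarrow> finite H"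
  using subgraph finite_complete_edges finite_subset by blast

lemma card_family_pos: "0 < card \<H>"
  using nonempty finite_family by (simp add: card_gt_0_iff)

lemma card_Int_le: "H \<in> \<H> \<Longrightarrow> card (H \<inter> H') \<le> m"
  using card_mono[of H "H \<inter> H'"] finite_member card_edges by auto

lemma card_Diff: "H \<in> \<H> \<Longrightarrow> H' \<in> \<H> \<Longrightarrow> card (H' - H) = m - card (H \<inter> H')"
  using card_Diff_subset_Int[of H' H] finite_member card_edges by (simp add: Int_commute)

text \<open>The members are grouped by their overlap \<open>l\<close> with \<open>H\<close>, which
  takes at most m + 1 values; the count at each admissible level times \<open>f l\<close> is at most
  \<open>card \<H> * B\<close>.\<close>

lemma sum_overlap_le:
  fixes f :: "nat \<Rightarrow> real" and B :: real
  assumes H: "H \<in> \<H>" and B: "0 \<le> B"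
    and f: "\<And>l. l \<le> m \<Longrightarrow> P l \<Longrightarrow> f l * exp (x - l * L) \<le> B" "\<And>l. 0 \<le> f l"
  shows "(\<Sum>H' | H' \<in> \<H> \<and> P (card (H \<inter> H')). f (card (H \<inter> H'))) \<le> card \<H> * ((m + 1) * B)"
proof -
  let ?S = "{H' \<in> \<H>. P (card (H \<inter> H'))}"
  have "(\<Sum>H'\<in>?S. f (card (H \<inter> H'))) =
      (\<Sum>l\<le>m. \<Sum>H' | H' \<in> ?S \<and> card (H \<inter> H') = l. f (card (H \<inter> H')))"
    using finite_family card_Int_le[OF H] by (intro sum.group[symmetric]) auto
  also have "\<dots> \<le> (\<Sum>l\<le>m. card \<H> * B)"
  proof (rule sum_mono)
    fix l assume "l \<in> {..m}"
    then have l: "l \<le> m" by simp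
    have "(\<Sum>H' | H' \<in> ?S \<and> card (H \<inter> H') = l. f (card (H \<inter> H'))) =
        card {H' \<in> ?S. card (H \<inter> H') = l} * f l"
      by simp
    also have "\<dots> \<le> card \<H> * B"
    proof (cases "P l")
      case True
      have "{H' \<in> ?S. card (H \<inter> H') = l} = {H' \<in> \<H>. card (H \<inter> H') = l}"
        using True by auto
      then have "card {H' \<in> ?S. card (H \<inter> H') = l} * f l \<le> (card \<H> * exp (x - l * L)) * f l"
        using card_overlap[OF H l] f(2) by (simp add: mult_right_mono)
      also have "\<dots> = card \<H> * (f l * exp (x - l * L))" by simp
      also have "\<dots> \<le> card \<H> * B"
        using f(1)[OF l True] by (intro mult_left_mono) simp_all
      finally show ?thesis .
    next
      case False
      then have empty: "{H' \<in> ?S. card (H \<inter> H') = l} = {}" by auto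
      show ?thesis unfolding empty using B by simp
    qed
    finally show "(\<Sum>H' | H' \<in> ?S \<and> card (H \<inter> H') = l. f (card (H \<inter> H'))) \<le> card \<H> * B" .
  qed
  finally show ?thesis by (simp add: algebra_simps)
qed

section \<open>Error probabilities as integrals under the null law\<close>

lemma estimation_law_gaussian_emeasure:
  assumes "K \<in> estimators n \<H>"
  shows "emeasure (estimation_law n \<H> (gaussian \<mu>) (gaussian 0) K)
      {(Hs, Hh) \<in> space (estimation_law n \<H> (gaussian \<mu>) (gaussian 0) K). R Hs Hh} =
    (\<Sum>H\<in>\<H>. \<integral>\<^sup>+A. ennreal (likelihood \<mu> H A) * emeasure (K A) {H' \<in> \<H>. R H H'} \<partial>null_law n) / card \<H>"
proof -
  have "(\<lambda>A. emeasure (K A) {H' \<in> \<H>. R H H'}) \<in> borel_measurable (null_law n)" for H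
    using assms unfolding estimators_def
    by (subst measurable_cong_sets[OF sets_null_law refl])
       (auto intro!: measurable_compose[OF measurable_prob_algebraD measurable_emeasure_subprob_algebra])
  moreover have "(\<lambda>A. ennreal (likelihood \<mu> H A)) \<in> borel_measurable (null_law n)" if "H \<in> \<H>" for H
    using subgraph[OF that] by measurable
  ultimately show ?thesis
    by (subst estimation_law_emeasure[OF finite_family nonempty assms])
       (simp_all add: prob_space_gaussian weight_law_gaussian subgraph nn_integral_density cong: sum.cong)
qed

text \<open>The sum over all hidden graphs is the natural quantity for the converse, where the
  likelihoods add up to the posterior normalizer; the uniform prior supplies the factor cancelled
  here.\<close>

lemma estimation_prob_le:
  fixes c \<mu> :: real
  assumes K: "K \<in> estimators n \<H>" and c: "0 \<le> c"
    and le: "(\<Sum>H\<in>\<H>. \<integral>\<^sup>+A. ennreal (likelihood \<mu> H A) * emeasure (K A) {H' \<in> \<H>. R H H'} \<partial>null_law n) \<le>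
      ennreal (card \<H> * c)"
  shows "\<P>((Hs, Hh) in estimation_law n \<H> (gaussian \<mu>) (gaussian 0) K. R Hs Hh) \<le> c"
proof -
  have "emeasure (estimation_law n \<H> (gaussian \<mu>) (gaussian 0) K)
      {(Hs, Hh) \<in> space (estimation_law n \<H> (gaussian \<mu>) (gaussian 0) K). R Hs Hh} \<le>
      ennreal (card \<H> * c) / card \<H>"
    unfolding estimation_law_gaussian_emeasure[OF K] by (rule divide_right_mono_ennreal[OF le])
  also have "\<dots> = ennreal c"
    using card_family_pos c by (simp add: ennreal_of_nat_eq_real_of_nat divide_ennreal)
  finally show ?thesis
    unfolding measure_def using c by (rule enn2real_leI[rotated])
qed

text \<open>Both halves of the theorem use a dominating variable of this shape: a Markov term with
  threshold \<open>a\<close> for the weights on \<open>H\<close>, plus weighted tilts on the edges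
  of other members outside \<open>H\<close>. With \<open>H\<close> hidden, each deviation has mean
  at most 1 and each tilt has mean 1.\<close>

lemma integral_deviation_plus_overlap:
  fixes a s \<mu> :: real and g :: "graph \<Rightarrow> real"
  assumes H: "H \<in> \<H>" and F: "F \<subseteq> \<H>" and a: "0 < a"
  defines "f \<equiv> \<lambda>A. likelihood \<mu> H A * ((\<Sum>e\<in>H. \<bar>A e - \<mu>\<bar>) / a + (\<Sum>H'\<in>F. g H' * likelihood s (H' - H) A))"
  shows "integrable (null_law n) f" and "(\<integral>A. f A \<partial>null_law n) \<le> m / a + (\<Sum>H'\<in>F. g H')"
proof -
  let ?dev = "\<lambda>A. (\<Sum>e\<in>H. likelihood \<mu> H A * \<bar>A e - \<mu>\<bar>) / a"
    and ?lik = "\<lambda>A. \<Sum>H'\<in>F. g H' * (likelihood \<mu> H A * likelihood s (H' - H) A)"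
  have lik: "integrable (null_law n) (\<lambda>A. likelihood \<mu> H A * likelihood s (H' - H) A)"
    "(\<integral>A. likelihood \<mu> H A * likelihood s (H' - H) A \<partial>null_law n) = 1" if "H' \<in> F" for H'
    using has_bochner_integral_likelihood_mult[of H n "H' - H" \<mu> s] subgraph[OF H] that F subgraph[of H']
    by (auto simp: has_bochner_integral_iff)
  note dev = integrable_likelihood_abs[OF subgraph[OF H], of _ \<mu>]
  have f: "f A = ?dev A + ?lik A" for A
    by (simp add: f_def distrib_left sum_distrib_left mult_ac)
  have int1: "integrable (null_law n) ?dev"
    by (intro integrable_divide Bochner_Integration.integrable_sum dev)
  have int2: "integrable (null_law n) ?lik"
    by (intro Bochner_Integration.integrable_sum integrable_mult_right impI lik)
  show "integrable (null_law n) f"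
    unfolding f using int1 int2 by (rule Bochner_Integration.integrable_add)
  have "(\<integral>A. ?dev A \<partial>null_law n) = (\<Sum>e\<in>H. \<integral>A. likelihood \<mu> H A * \<bar>A e - \<mu>\<bar> \<partial>null_law n) / a"
    by (subst integral_divide_zero, subst Bochner_Integration.integral_sum) (auto intro: dev)
  also have "\<dots> \<le> (\<Sum>e\<in>H. 1) / a"
    using a dev(2) by (intro divide_right_mono sum_mono) auto
  finally have "(\<integral>A. ?dev A \<partial>null_law n) \<le> m / a"
    using card_edges[OF H] by simp
  moreover have "(\<integral>A. ?lik A \<partial>null_law n) = (\<Sum>H'\<in>F. g H')"
    by (subst Bochner_Integration.integral_sum) (auto intro!: integrable_mult_right sum.cong simp: lik)
  ultimately show "(\<integral>A. f A \<partial>null_law n) \<le> m / a + (\<Sum>H'\<in>F. g H')"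
    unfolding f by (subst Bochner_Integration.integral_add[OF int1 int2]) simp
qed

section \<open>Maximum likelihood above the threshold\<close>

lemma sum_Diff_ge:
  fixes A :: "nat set \<Rightarrow> real" and \<mu> :: real
  assumes H: "H \<in> \<H>" and H': "H' \<in> \<H>"
  shows "(\<Sum>e\<in>H - H'. A e) \<ge> real (m - card (H \<inter> H')) * \<mu> - (\<Sum>e\<in>H. \<bar>A e - \<mu>\<bar>)"
proof -
  have "(\<Sum>e\<in>H - H'. \<mu> - A e) \<le> (\<Sum>e\<in>H. \<bar>A e - \<mu>\<bar>)"
  proof (rule order_trans)
    show "(\<Sum>e\<in>H - H'. \<mu> - A e) \<le> (\<Sum>e\<in>H - H'. \<bar>A e - \<mu>\<bar>)"
      by (rule sum_mono) simp
    show "(\<Sum>e\<in>H - H'. \<bar>A e - \<mu>\<bar>) \<le> (\<Sum>e\<in>H. \<bar>A e - \<mu>\<bar>)"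
      using finite_member[OF H] by (intro sum_mono2) auto
  qed
  moreover have "card (H - H') = m - card (H \<inter> H')"
    using card_Diff[OF H' H] by (simp add: Int_commute)
  ultimately show ?thesis
    by (simp add: sum_subtractf)
qed

text \<open>The first term is Markov's bound for a deviation of \<theta> \<delta> m \<mu> on the
  hidden edges, the second a union bound over competitors of small overlap. Giving up a fraction
  \<theta> of the mean leaves the competitor a deterministic threshold to reach, which decouples it
  from the hidden weights.\<close>

lemma maximum_likelihood_overlap:
  fixes \<mu> \<eta> \<theta> \<delta> :: real
  assumes K: "K \<in> maximum_likelihood_estimators n \<H> (gaussian \<mu>) (gaussian 0)"
    and card: "card \<H> = exp (m * L)"
    and \<mu>: "0 < \<mu>" "(1 + \<eta>) * L \<le> \<mu>\<^sup>2 / 2" and \<theta>: "0 < \<theta>" "\<theta> < 1"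
    and \<eta>: "0 < \<eta>" "1 + \<eta> / 2 \<le> (1 - \<theta>)\<^sup>2 * (1 + \<eta>)" and \<delta>: "0 < \<delta>"
  shows "\<P>((Hs, Hh) in estimation_law n \<H> (gaussian \<mu>) (gaussian 0) K.
      real (card (Hh \<inter> Hs)) < (1 - \<delta>) * m) \<le>
    1 / (\<theta> * \<delta> * \<mu>) + (m + 1) * exp (x - \<delta> * m * \<eta> * L / 2)"
proof -
  \<comment> \<open>With \<open>H\<close> hidden, the weights on \<open>H' - H\<close> are standard
    normal and have to sum to \<open>s * k H H'\<close>; the optimal Chernoff tilt is then
    \<open>s\<close> itself, with bound exp(- k s^2 / 2).\<close>
  define s where "s = (1 - \<theta>) * \<mu>"
  define bad where "bad H = {H' \<in> \<H>. card (H \<inter> H') < (1 - \<delta>) * m}" for H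
  define k where "k H H' = real (m - card (H \<inter> H'))" for H H' :: graph
  \<comment> \<open>At least 1 whenever a graph in \<open>bad H\<close> ties or beats
    \<open>H\<close>, so it dominates the conditional error probability however ties are
    broken.\<close>
  define Y where "Y H A = (\<Sum>e\<in>H. \<bar>A e - \<mu>\<bar>) / (\<theta> * \<delta> * m * \<mu>) +
      (\<Sum>H'\<in>bad H. exp (- k H H' * s\<^sup>2 / 2) * likelihood s (H' - H) A)" for H A
  have KE: "K \<in> estimators n \<H>"
    and Kmax: "\<And>A. A \<in> space (weight_space n) \<Longrightarrow> AE H in K A.
        is_arg_max (\<lambda>H. \<Sum>e\<in>H. log_likelihood_ratio (gaussian \<mu>) (gaussian 0) (A e)) (\<lambda>H. H \<in> \<H>) H"
    using K by (auto simp: maximum_likelihood_estimators_def)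
  have s: "0 < s" using \<mu> \<theta> by (simp add: s_def)
  have Y_nonneg: "0 \<le> Y H A" for H A
    using \<mu> \<theta> \<delta> by (auto simp: Y_def intro!: add_nonneg_nonneg sum_nonneg divide_nonneg_nonneg)
  have bad_subset: "bad H \<subseteq> \<H>" for H by (auto simp: bad_def)

  have Y_ge_1: "1 \<le> Y H A"
    if H: "H \<in> \<H>" and H': "H' \<in> bad H" and le: "(\<Sum>e\<in>H. A e) \<le> (\<Sum>e\<in>H'. A e)" for H H' A
  proof (cases "\<theta> * \<delta> * m * \<mu> \<le> (\<Sum>e\<in>H. \<bar>A e - \<mu>\<bar>)")
    case True
    then have "1 \<le> (\<Sum>e\<in>H. \<bar>A e - \<mu>\<bar>) / (\<theta> * \<delta> * m * \<mu>)"
      using \<mu> \<theta> \<delta> m_pos by simp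
    moreover have "0 \<le> (\<Sum>H'\<in>bad H. exp (- k H H' * s\<^sup>2 / 2) * likelihood s (H' - H) A)"
      by (intro sum_nonneg) simp
    ultimately show ?thesis by (simp add: Y_def)
  next
    case False
    have H'\<H>: "H' \<in> \<H>" using H' by (simp add: bad_def)
    have k: "\<delta> * m \<le> k H H'"
      using H' card_Int_le[OF H, of H'] by (auto simp: k_def bad_def algebra_simps of_nat_diff)
    \<comment> \<open>Since k is at least \<delta> m, the tolerated deviation costs at most a
      fraction \<theta> of k \<mu>.\<close>
    have "s * k H H' \<le> k H H' * \<mu> - \<theta> * (\<delta> * m) * \<mu>"
      using mult_left_mono[OF k, of "\<theta> * \<mu>"] \<mu> \<theta> by (simp add: s_def algebra_simps)
    also have "\<dots> \<le> (\<Sum>e\<in>H - H'. A e)"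
      using sum_Diff_ge[OF H H'\<H>, where \<mu> = \<mu> and A = A] False by (simp add: k_def mult.assoc)
    \<comment> \<open>The common edges cancel when the two weight sums are compared.\<close>
    also have "\<dots> \<le> (\<Sum>e\<in>H' - H. A e)"
      using le sum.Int_Diff[OF finite_member[OF H], where B = H' and g = A]
        sum.Int_Diff[OF finite_member[OF H'\<H>], where B = H and g = A]
      by (simp add: Int_commute)
    finally have "s * (s * k H H') \<le> s * (\<Sum>e\<in>H' - H. A e)"
      using s by (intro mult_left_mono) auto
    moreover have "exp (- k H H' * s\<^sup>2 / 2) * likelihood s (H' - H) A =
        exp (s * (\<Sum>e\<in>H' - H. A e) - s * (s * k H H'))"
      unfolding likelihood_eq_exp[OF finite_Diff[OF finite_member[OF H'\<H>]]] card_Diff[OF H H'\<H>]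
      by (simp add: k_def power2_eq_square field_simps flip: exp_add)
    ultimately have "1 \<le> exp (- k H H' * s\<^sup>2 / 2) * likelihood s (H' - H) A"
      by simp
    also have "\<dots> \<le> (\<Sum>H'\<in>bad H. exp (- k H H' * s\<^sup>2 / 2) * likelihood s (H' - H) A)"
      using H' finite_subset[OF bad_subset finite_family]
      by (intro member_le_sum) auto
    also have "\<dots> \<le> Y H A"
      using \<mu> \<theta> \<delta> by (auto simp: Y_def intro!: sum_nonneg divide_nonneg_nonneg)
    finally show ?thesis .
  qed

  have error_le: "AE A in null_law n. ennreal (likelihood \<mu> H A) *
      emeasure (K A) {H' \<in> \<H>. real (card (H' \<inter> H)) < (1 - \<delta>) * m} \<le> ennreal (likelihood \<mu> H A * Y H A)"
    if H: "H \<in> \<H>" for H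
    using AE_log_likelihood_ratio[of n \<mu>] AE_space
  proof eventually_elim
    case (elim A)
    have A: "A \<in> space (weight_space n)"
      using elim(2) sets_eq_imp_space_eq[OF sets_null_law] by simp
    have KA: "sets (K A) = Pow \<H>" "space (K A) = \<H>" "prob_space (K A)"
      using measurable_space[OF KE[unfolded estimators_def] A] sets_eq_imp_space_eq[of "K A" "count_space \<H>"]
      by (auto simp: space_prob_algebra)
    have bad: "{H' \<in> \<H>. real (card (H' \<inter> H)) < (1 - \<delta>) * m} = bad H"
      by (simp add: bad_def Int_commute)
    \<comment> \<open>All members have m edges, so the score is the same increasing function of the
      plain weight sum for each of them.\<close>
    have score: "(\<Sum>e\<in>H'. log_likelihood_ratio (gaussian \<mu>) (gaussian 0) (A e)) =
        \<mu> * (\<Sum>e\<in>H'. A e) - m * \<mu>\<^sup>2 / 2" if "H' \<in> \<H>" for H'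
    proof -
      have "(\<Sum>e\<in>H'. log_likelihood_ratio (gaussian \<mu>) (gaussian 0) (A e)) = (\<Sum>e\<in>H'. \<mu> * A e - \<mu>\<^sup>2 / 2)"
        using elim(1) subgraph[OF that] by (intro sum.cong) auto
      then show ?thesis
        using card_edges[OF that] by (simp add: sum_subtractf sum_distrib_left)
    qed
    have "emeasure (K A) (bad H) \<le> ennreal (Y H A)"
    \<comment> \<open>If some bad graph ties or beats \<open>H\<close>, bounding a probability by 1
      suffices; otherwise no bad graph maximizes the score and the error mass vanishes.\<close>
    proof (cases "\<exists>H'\<in>bad H. (\<Sum>e\<in>H. A e) \<le> (\<Sum>e\<in>H'. A e)")
      case True
      then have "1 \<le> Y H A" using Y_ge_1[OF H] by blast
      then show ?thesis
        using prob_space.emeasure_le_1[OF KA(3), of "bad H"] by (metis ennreal_1 ennreal_leI order_trans)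
    next
      case False
      have "AE H' in K A. H' \<notin> bad H"
        using Kmax[OF A]
      proof eventually_elim
        case (elim H')
        show ?case
        proof
          assume H': "H' \<in> bad H"
          then have "(\<Sum>e\<in>H'. A e) < (\<Sum>e\<in>H. A e)" using False by force
          then have "\<mu> * (\<Sum>e\<in>H'. A e) < \<mu> * (\<Sum>e\<in>H. A e)" using \<mu> by simp
          with elim H H' show False
            by (auto simp: is_arg_max_def score bad_def)
        qed
      qed
      then have "emeasure (K A) (bad H) = 0"
        using bad_subset[of H] KA by (subst (asm) AE_iff_measurable[of "bad H"]) auto
      then show ?thesis by simp
    qed
    then show ?case
      unfolding bad by (subst ennreal_mult) (auto simp: Y_nonneg intro: mult_left_mono)
  qed

  have integral_le: "(\<integral>\<^sup>+A. ennreal (likelihood \<mu> H A) *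
      emeasure (K A) {H' \<in> \<H>. real (card (H' \<inter> H)) < (1 - \<delta>) * m} \<partial>null_law n) \<le>
      ennreal (1 / (\<theta> * \<delta> * \<mu>) + (m + 1) * exp (x - \<delta> * m * \<eta> * L / 2))" (is "?I \<le> _")
    if H: "H \<in> \<H>" for H
  proof -
    have pos: "0 < \<theta> * \<delta> * m * \<mu>" using \<mu> \<theta> \<delta> m_pos by simp
    have int: "integrable (null_law n) (\<lambda>A. likelihood \<mu> H A * Y H A)"
      unfolding Y_def by (rule integral_deviation_plus_overlap(1)[OF H bad_subset pos])
    have int_le: "(\<integral>A. likelihood \<mu> H A * Y H A \<partial>null_law n) \<le>
        m / (\<theta> * \<delta> * m * \<mu>) + (\<Sum>H'\<in>bad H. exp (- k H H' * s\<^sup>2 / 2))"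
      unfolding Y_def by (rule integral_deviation_plus_overlap(2)[OF H bad_subset pos])
    have "?I \<le> (\<integral>\<^sup>+A. ennreal (likelihood \<mu> H A * Y H A) \<partial>null_law n)"
      by (rule nn_integral_mono_AE) (rule error_le[OF H])
    also have "\<dots> = ennreal (\<integral>A. likelihood \<mu> H A * Y H A \<partial>null_law n)"
      by (rule nn_integral_eq_integral[OF int]) (simp add: Y_nonneg)
    also have "(\<integral>A. likelihood \<mu> H A * Y H A \<partial>null_law n) \<le>
        1 / (\<theta> * \<delta> * \<mu>) + (\<Sum>H'\<in>bad H. exp (- k H H' * s\<^sup>2 / 2))"
      using int_le m_pos by simp
    also have "(\<Sum>H'\<in>bad H. exp (- k H H' * s\<^sup>2 / 2)) \<le> (m + 1) * exp (x - \<delta> * m * \<eta> * L / 2)"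
    proof -
      \<comment> \<open>At overlap \<open>l\<close> there are at most exp(m L + x - l L)
        competitors, each contributing exp(- (m - l) s^2 / 2). As s^2 / 2 is at least (1 + \<eta> /
        2) L, this leaves exp(x - (m - l) \<eta> L / 2) with m - l above \<delta> m. Dividing by
        \<open>card \<H>\<close> offsets the factor in \<open>sum_overlap_le\<close>.\<close>
      let ?B = "exp (x - \<delta> * m * \<eta> * L / 2) / card \<H>"
      have s_ge: "(1 + \<eta> / 2) * L \<le> s\<^sup>2 / 2"
      proof -
        have "(1 + \<eta> / 2) * L \<le> (1 - \<theta>)\<^sup>2 * (1 + \<eta>) * L"
          using \<eta>(2) L_nonneg by (rule mult_right_mono)
        also have "\<dots> \<le> (1 - \<theta>)\<^sup>2 * (\<mu>\<^sup>2 / 2)"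
          using mult_left_mono[OF \<mu>(2), of "(1 - \<theta>)\<^sup>2"] by (simp add: mult.assoc)
        finally show ?thesis by (simp add: s_def power_mult_distrib)
      qed
      have "(\<Sum>H'\<in>bad H. exp (- k H H' * s\<^sup>2 / 2)) =
          (\<Sum>H' | H' \<in> \<H> \<and> real (card (H \<inter> H')) < (1 - \<delta>) * m. exp (- real (m - card (H \<inter> H')) * s\<^sup>2 / 2))"
        by (simp add: bad_def k_def)
      also have "\<dots> \<le> card \<H> * ((m + 1) * ?B)"
      proof (rule sum_overlap_le[OF H])
        fix l assume l: "l \<le> m" "real l < (1 - \<delta>) * m"
        have "(m - l) * ((1 + \<eta> / 2) * L) \<le> (m - l) * (s\<^sup>2 / 2)"
          using s_ge by (intro mult_left_mono) auto
        moreover have "(\<delta> * m) * (\<eta> * L / 2) \<le> (m - l) * (\<eta> * L / 2)"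
          using l \<eta> L_nonneg by (intro mult_right_mono) (auto simp: of_nat_diff algebra_simps)
        moreover have "x - l * L + m * L = x + (m - l) * L"
          using l(1) by (simp add: of_nat_diff algebra_simps)
        ultimately have "- real (m - l) * s\<^sup>2 / 2 + (x - l * L) + m * L \<le> x - \<delta> * m * \<eta> * L / 2"
          by (simp add: distrib_left distrib_right mult.assoc)
        then have "exp (- real (m - l) * s\<^sup>2 / 2) * exp (x - l * L) * exp (m * L) \<le> exp (x - \<delta> * m * \<eta> * L / 2)"
          by (simp flip: exp_add)
        then show "exp (- real (m - l) * s\<^sup>2 / 2) * exp (x - l * L) \<le> ?B"
          unfolding card by (simp add: pos_le_divide_eq)
      qed auto
      also have "\<dots> = (m + 1) * exp (x - \<delta> * m * \<eta> * L / 2)"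
        using card_family_pos by simp
      finally show "(\<Sum>H'\<in>bad H. exp (- k H H' * s\<^sup>2 / 2)) \<le> (m + 1) * exp (x - \<delta> * m * \<eta> * L / 2)" .
    qed
    finally show ?thesis by (simp add: ennreal_leI add_left_mono)
  qed
  have "(\<Sum>H\<in>\<H>. \<integral>\<^sup>+A. ennreal (likelihood \<mu> H A) *
      emeasure (K A) {H' \<in> \<H>. real (card (H' \<inter> H)) < (1 - \<delta>) * m} \<partial>null_law n) \<le>
      (\<Sum>H\<in>\<H>. ennreal (1 / (\<theta> * \<delta> * \<mu>) + (m + 1) * exp (x - \<delta> * m * \<eta> * L / 2)))"
    by (rule sum_mono) (rule integral_le)
  also have "\<dots> = ennreal (card \<H> * (1 / (\<theta> * \<delta> * \<mu>) + (m + 1) * exp (x - \<delta> * m * \<eta> * L / 2)))"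
    using \<mu> \<theta> \<delta> by (subst sum_ennreal) (auto intro!: add_nonneg_nonneg)
  finally show ?thesis
    using \<mu> \<theta> \<delta> by (intro estimation_prob_le[OF KE]) (auto intro!: add_nonneg_nonneg)
qed

section \<open>Impossibility below the threshold\<close>

lemma likelihood_le:
  fixes A :: "nat set \<Rightarrow> real" and \<mu> b :: real
  assumes H: "H \<in> \<H>" and H': "H' \<in> \<H>" and dev: "(\<Sum>e\<in>H. \<bar>A e - \<mu>\<bar>) \<le> b" and \<mu>: "0 \<le> \<mu>"
  shows "likelihood \<mu> H' A \<le> exp (real (card (H \<inter> H')) * \<mu>\<^sup>2 / 2 + \<mu> * b) * likelihood \<mu> (H' - H) A"
proof -
  have fin: "finite (H \<inter> H')" "finite (H' - H)"
    using finite_member H H' by auto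
  have "(\<Sum>e\<in>H \<inter> H'. A e - \<mu>) \<le> (\<Sum>e\<in>H \<inter> H'. \<bar>A e - \<mu>\<bar>)"
    by (rule sum_mono) simp
  also have "\<dots> \<le> (\<Sum>e\<in>H. \<bar>A e - \<mu>\<bar>)"
    using finite_member[OF H] by (intro sum_mono2) auto
  finally have "(\<Sum>e\<in>H \<inter> H'. A e) \<le> real (card (H \<inter> H')) * \<mu> + b"
    using dev by (simp add: sum_subtractf)
  then have "\<mu> * (\<Sum>e\<in>H \<inter> H'. A e) \<le> \<mu> * (real (card (H \<inter> H')) * \<mu> + b)"
    using \<mu> by (rule mult_left_mono)
  \<comment> \<open>For overlap l the exponent is at most \<mu> (l \<mu> + b) - l \<mu>^2 / 2. This
    replaces the weights on the shared edges by a constant, so the remaining factor depends only on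
    weights off \<open>H\<close>.\<close>
  then have "likelihood \<mu> (H \<inter> H') A \<le> exp (real (card (H \<inter> H')) * \<mu>\<^sup>2 / 2 + \<mu> * b)"
    unfolding likelihood_eq_exp[OF fin(1)] by (simp add: power2_eq_square field_simps)
  moreover have "likelihood \<mu> H' A = likelihood \<mu> (H \<inter> H') A * likelihood \<mu> (H' - H) A"
    unfolding likelihood_def using finite_member[OF H']
    by (subst Int_commute) (rule prod.Int_Diff)
  ultimately show ?thesis
    by (simp add: mult_right_mono)
qed

(* The posterior mass of the sets overlapping H is estimated in three regimes: the normalizer is
   at most t * card \<H>; the weights on H deviate; neither. *)
lemma posterior_overlap_le:
  fixes A :: "nat set \<Rightarrow> real" and \<mu> lam t C :: real
  assumes \<mu>: "0 \<le> \<mu>" and t: "0 < t" and C: "0 < C"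
  defines "near H \<equiv> {H' \<in> \<H>. lam * m \<le> card (H \<inter> H')}"
    and "Z \<equiv> (\<Sum>H\<in>\<H>. likelihood \<mu> H A)"
  shows "(\<Sum>H\<in>\<H>. likelihood \<mu> H A * ((\<Sum>H'\<in>near H. likelihood \<mu> H' A) / Z)) \<le>
    t * card \<H> + (\<Sum>H\<in>\<H>. likelihood \<mu> H A * ((\<Sum>e\<in>H. \<bar>A e - \<mu>\<bar>) / (C * m) +
      (\<Sum>H'\<in>near H. exp (real (card (H \<inter> H')) * \<mu>\<^sup>2 / 2 + \<mu> * (C * m)) * likelihood \<mu> (H' - H) A) /
        (t * card \<H>)))" (is "?l \<le> _ + (\<Sum>H\<in>\<H>. _ * (?dev H + ?far H))")
proof -
  have Z: "0 < Z"
    unfolding Z_def using finite_family nonempty by (intro sum_pos) auto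
  have fin: "finite (near H)" for H
    using finite_family by (simp add: near_def)
  have post_le_1: "(\<Sum>H'\<in>near H. likelihood \<mu> H' A) / Z \<le> 1" for H
    using Z finite_family by (auto simp: Z_def near_def intro!: sum_mono2)
  have dev: "0 \<le> ?dev H" and far: "0 \<le> ?far H" for H
    using t C by (auto intro!: sum_nonneg divide_nonneg_nonneg mult_nonneg_nonneg)
  have nonneg: "0 \<le> (\<Sum>H\<in>\<H>. likelihood \<mu> H A * (?dev H + ?far H))"
    using dev far by (intro sum_nonneg mult_nonneg_nonneg add_nonneg_nonneg) auto
  show ?thesis
  proof (cases "Z \<le> t * card \<H>")
    case True
    \<comment> \<open>A posterior mass is at most 1, so the sum is at most the normalizer itself,
      which is small in this case.\<close>
    have "?l \<le> (\<Sum>H\<in>\<H>. likelihood \<mu> H A * 1)"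
      using post_le_1 by (intro sum_mono mult_left_mono) auto
    then show ?thesis using True nonneg by (simp add: Z_def)
  next
    case False
    have "(\<Sum>H'\<in>near H. likelihood \<mu> H' A) / Z \<le> ?dev H + ?far H" if H: "H \<in> \<H>" for H
    proof (cases "(\<Sum>e\<in>H. \<bar>A e - \<mu>\<bar>) \<le> C * m")
      case True
      have "(\<Sum>H'\<in>near H. likelihood \<mu> H' A) / Z \<le>
          (\<Sum>H'\<in>near H. exp (real (card (H \<inter> H')) * \<mu>\<^sup>2 / 2 + \<mu> * (C * m)) * likelihood \<mu> (H' - H) A) / Z"
        using Z likelihood_le[OF H _ True \<mu>] by (intro divide_right_mono sum_mono) (auto simp: near_def)
      also have "\<dots> \<le> ?far H"
        using False t card_family_pos Z by (intro divide_left_mono sum_nonneg mult_pos_pos) auto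
      finally show ?thesis using dev[of H] by simp
    next
      case False
      then have "1 \<le> ?dev H" using C m_pos by simp
      then show ?thesis using post_le_1[of H] far[of H] by linarith
    qed
    then have "?l \<le> (\<Sum>H\<in>\<H>. likelihood \<mu> H A * (?dev H + ?far H))"
      by (intro sum_mono mult_left_mono) auto
    moreover have "0 \<le> t * card \<H>" using t by simp
    ultimately show ?thesis by linarith
  qed
qed

(* AM-GM linearizes the second moment bound overlap_second_moment for the posterior. *)
lemma kernel_overlap_le:
  fixes A :: "nat set \<Rightarrow> real" and \<kappa> :: "graph \<Rightarrow> real" and \<mu> lam lam' \<delta> :: real
  assumes \<kappa>: "\<And>H. H \<in> \<H> \<Longrightarrow> 0 \<le> \<kappa> H" "sum \<kappa> \<H> = 1"
    and lam: "0 < lam" and \<delta>: "0 < \<delta>" and lam': "lam' = \<delta>\<^sup>2 * lam\<^sup>2 / 2"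
  defines "Z \<equiv> (\<Sum>H\<in>\<H>. likelihood \<mu> H A)"
  shows "(\<Sum>H\<in>\<H>. likelihood \<mu> H A * (\<Sum>H' | H' \<in> \<H> \<and> lam * m \<le> card (H' \<inter> H). \<kappa> H')) \<le>
    3 * \<delta> / 4 * Z + 1 / (2 * \<delta> * lam\<^sup>2) *
      (\<Sum>H\<in>\<H>. likelihood \<mu> H A * ((\<Sum>H' | H' \<in> \<H> \<and> lam' * m \<le> card (H \<inter> H'). likelihood \<mu> H' A) / Z))"
proof -
  define p where "p H = likelihood \<mu> H A / Z" for H
  define q where "q F = (\<Sum>H | H \<in> \<H> \<and> lam * m \<le> card (F \<inter> H). p H)" for F
  define S where "S = (\<Sum>H\<in>\<H>. p H * (\<Sum>H' | H' \<in> \<H> \<and> lam' * m \<le> card (H \<inter> H'). p H'))"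
  have Z: "0 < Z"
    unfolding Z_def using finite_family nonempty by (intro sum_pos) auto
  have lam'_nonneg: "0 \<le> lam'" unfolding lam' by simp
  have w: "likelihood \<mu> H A = Z * p H" for H using Z by (simp add: p_def)
  have post: "(\<Sum>H\<in>F. likelihood \<mu> H A) / Z = sum p F" for F
    by (simp add: p_def sum_divide_distrib)
  have p: "0 \<le> p H" for H using Z by (simp add: p_def)
  have sum1: "sum p \<H> = 1"
    using Z by (simp add: p_def Z_def flip: sum_divide_distrib)
  have q_le: "q F \<le> 3 * \<delta> / 4 + S / (2 * \<delta> * lam\<^sup>2)" if F: "F \<in> \<H>" for F
  proof -
    have "(lam * q F)\<^sup>2 \<le> lam' + S"
      unfolding q_def S_def
      by (rule overlap_second_moment)
         (use F p sum1 lam lam'_nonneg finite_family finite_member card_edges m_pos in auto)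
    \<comment> \<open>The value of \<open>lam'\<close> is chosen to make lam' / lam^2 equal to
      \<delta>^2 / 2.\<close>
    then have "(q F)\<^sup>2 * lam\<^sup>2 \<le> \<delta>\<^sup>2 / 2 * lam\<^sup>2 + S / lam\<^sup>2 * lam\<^sup>2"
      using lam by (simp add: lam' power_mult_distrib mult.commute)
    then have "(q F)\<^sup>2 * lam\<^sup>2 \<le> (\<delta>\<^sup>2 / 2 + S / lam\<^sup>2) * lam\<^sup>2"
      by (simp only: distrib_right)
    then have q2: "(q F)\<^sup>2 \<le> \<delta>\<^sup>2 / 2 + S / lam\<^sup>2"
      using lam by (simp only: mult_le_cancel_right zero_less_power2 power2_less_0)
    have "2 * \<delta> * q F \<le> \<delta>\<^sup>2 + (q F)\<^sup>2"
      using sum_squares_bound[of \<delta> "q F"] by simp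
    also have "\<dots> \<le> 3 / 2 * \<delta>\<^sup>2 + S / lam\<^sup>2" using q2 by simp
    \<comment> \<open>The resulting constant 3/4 leaves \<delta> / 4 for all other errors.\<close>
    also have "\<dots> = 2 * \<delta> * (3 * \<delta> / 4 + S / (2 * \<delta> * lam\<^sup>2))"
      using \<delta> by (simp add: field_simps power2_eq_square)
    finally show ?thesis using \<delta> by simp
  qed
  have "(\<Sum>H\<in>\<H>. likelihood \<mu> H A * (\<Sum>H' | H' \<in> \<H> \<and> lam * m \<le> card (H' \<inter> H). \<kappa> H')) =
      (\<Sum>H\<in>\<H>. \<Sum>H'\<in>\<H>. Z * (p H * (\<kappa> H' * of_bool (lam * m \<le> card (H' \<inter> H)))))"
    using finite_family by (simp add: w sum_distrib_left sum.inter_filter of_bool_def if_distrib mult.assoc cong: if_cong)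
  \<comment> \<open>The exchange puts the estimator's output outside: given the weights, the hidden
    graph is a posterior draw independent of the output, so each output can be bounded
    separately.\<close>
  also have "\<dots> = (\<Sum>H'\<in>\<H>. \<Sum>H\<in>\<H>. Z * (p H * (\<kappa> H' * of_bool (lam * m \<le> card (H' \<inter> H)))))"
    by (rule sum.swap)
  also have "\<dots> = Z * (\<Sum>F\<in>\<H>. \<kappa> F * q F)"
    using finite_family by (simp add: q_def sum_distrib_left sum.inter_filter of_bool_def if_distrib mult_ac cong: if_cong)
  also have "\<dots> \<le> Z * (\<Sum>F\<in>\<H>. \<kappa> F * (3 * \<delta> / 4 + S / (2 * \<delta> * lam\<^sup>2)))"
    using Z q_le \<kappa>(1) by (intro mult_left_mono sum_mono) auto
  also have "\<dots> = Z * (3 * \<delta> / 4 + S / (2 * \<delta> * lam\<^sup>2))"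
    by (simp add: \<kappa>(2) flip: sum_distrib_right)
  also have "\<dots> = 3 * \<delta> / 4 * Z + 1 / (2 * \<delta> * lam\<^sup>2) * (Z * S)"
    by (simp add: algebra_simps)
  also have "Z * S = (\<Sum>H\<in>\<H>. likelihood \<mu> H A *
      ((\<Sum>H' | H' \<in> \<H> \<and> lam' * m \<le> card (H \<inter> H'). likelihood \<mu> H' A) / Z))"
    by (simp only: post, simp only: w S_def sum_distrib_left mult.assoc)
  finally show ?thesis .
qed

text \<open>The bound collects 3 \<delta> / 4 from AM-GM, \<open>t\<close> from small posterior
  normalizers, \<open>1 / C\<close> from Markov's inequality for a deviation of \<open>C * m\<close>
  on the hidden edges, and the posterior mass of members with overlap at least lam' m.\<close>

lemma estimator_overlap:
  fixes \<mu> \<eta> t C lam lam' \<delta> :: real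
  assumes K: "K \<in> estimators n \<H>"
    and \<mu>: "0 < \<mu>" "\<mu>\<^sup>2 / 2 \<le> (1 - \<eta>) * L" and \<eta>: "0 \<le> \<eta>"
    and t: "0 < t" and C: "0 < C" and lam: "0 < lam" and \<delta>: "0 < \<delta>"
    and lam': "lam' = \<delta>\<^sup>2 * lam\<^sup>2 / 2"
  shows "\<P>((Hs, Hh) in estimation_law n \<H> (gaussian \<mu>) (gaussian 0) K.
      lam * m \<le> real (card (Hh \<inter> Hs))) \<le>
    3 * \<delta> / 4 + (t + 1 / C + (m + 1) * exp (x - lam' * m * \<eta> * L + \<mu> * (C * m)) / t) / (2 * \<delta> * lam\<^sup>2)"
proof -
  define near where "near H = {H' \<in> \<H>. lam' * m \<le> card (H \<inter> H')}" for H
  \<comment> \<open>The bound of \<open>likelihood_le\<close> on the shared edges, divided by the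
    lower bound \<open>t * card \<H>\<close> for the normalizer.\<close>
  define w where "w l = exp (real l * \<mu>\<^sup>2 / 2 + \<mu> * (C * m)) / (t * card \<H>)" for l
  define W where "W H A = (\<Sum>e\<in>H. \<bar>A e - \<mu>\<bar>) / (C * m) +
      (\<Sum>H'\<in>near H. w (card (H \<inter> H')) * likelihood \<mu> (H' - H) A)" for H A
  define c where "c = 1 / (2 * \<delta> * lam\<^sup>2)"
  \<comment> \<open>No ratio of random quantities is left: the normalizer has been replaced by a
    constant, so \<open>Y\<close> can be integrated term by term.\<close>
  define Y where "Y A = (\<Sum>H\<in>\<H>. 3 * \<delta> / 4 * likelihood \<mu> H A) +
      (c * (t * card \<H>) + (\<Sum>H\<in>\<H>. c * (likelihood \<mu> H A * W H A)))" for A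
  define B where "B = exp (x - lam' * m * \<eta> * L + \<mu> * (C * m))"
  have c: "0 < c" using \<delta> lam by (simp add: c_def)
  have W_nonneg: "0 \<le> W H A" for H A
    using C t by (auto simp: W_def w_def intro!: add_nonneg_nonneg sum_nonneg divide_nonneg_nonneg mult_nonneg_nonneg)
  have Y_nonneg: "0 \<le> Y A" for A
    using c t \<delta> W_nonneg by (auto simp: Y_def intro!: add_nonneg_nonneg sum_nonneg mult_nonneg_nonneg)
  have near_subset: "near H \<subseteq> \<H>" for H by (auto simp: near_def)
  have K': "K \<in> weight_space n \<rightarrow>\<^sub>M prob_algebra (count_space \<H>)"
    using K by (simp add: estimators_def)

  have pointwise: "(\<Sum>H\<in>\<H>. ennreal (likelihood \<mu> H A) *
      emeasure (K A) {H' \<in> \<H>. lam * m \<le> real (card (H' \<inter> H))}) \<le> ennreal (Y A)"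
    if "A \<in> space (null_law n)" for A
  proof -
    have A: "A \<in> space (weight_space n)"
      using that sets_eq_imp_space_eq[OF sets_null_law] by simp
    have KA: "sets (K A) = Pow \<H>" "space (K A) = \<H>" "prob_space (K A)"
      using measurable_space[OF K' A] sets_eq_imp_space_eq[of "K A" "count_space \<H>"]
      by (auto simp: space_prob_algebra)
    interpret prob_space "K A" by (rule KA(3))
    define \<kappa> where "\<kappa> H = measure (K A) {H}" for H
    have measure: "measure (K A) S = sum \<kappa> S" if "S \<subseteq> \<H>" for S
      unfolding \<kappa>_def using that finite_subset[OF that finite_family]
      by (intro finite_measure_eq_sum_singleton) (auto simp: KA)
    have \<kappa>: "0 \<le> \<kappa> H" "sum \<kappa> \<H> = 1" for H
      using measure[of \<H>] prob_space by (auto simp: \<kappa>_def KA)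
    let ?Z = "\<Sum>H\<in>\<H>. likelihood \<mu> H A"
    have "(\<Sum>H\<in>\<H>. ennreal (likelihood \<mu> H A) * emeasure (K A) {H' \<in> \<H>. lam * m \<le> real (card (H' \<inter> H))}) =
        (\<Sum>H\<in>\<H>. ennreal (likelihood \<mu> H A * (\<Sum>H' | H' \<in> \<H> \<and> lam * m \<le> card (H' \<inter> H). \<kappa> H')))"
    proof (rule sum.cong[OF refl])
      fix H
      have "emeasure (K A) {H' \<in> \<H>. lam * m \<le> real (card (H' \<inter> H))} =
          ennreal (\<Sum>H' | H' \<in> \<H> \<and> lam * m \<le> card (H' \<inter> H). \<kappa> H')"
        unfolding emeasure_eq_measure by (subst measure) auto
      then show "ennreal (likelihood \<mu> H A) * emeasure (K A) {H' \<in> \<H>. lam * m \<le> real (card (H' \<inter> H))} =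
          ennreal (likelihood \<mu> H A * (\<Sum>H' | H' \<in> \<H> \<and> lam * m \<le> card (H' \<inter> H). \<kappa> H'))"
        using \<kappa>(1) by (simp add: ennreal_mult sum_nonneg)
    qed
    also have "\<dots> = ennreal (\<Sum>H\<in>\<H>. likelihood \<mu> H A * (\<Sum>H' | H' \<in> \<H> \<and> lam * m \<le> card (H' \<inter> H). \<kappa> H'))"
      using \<kappa>(1) by (intro sum_ennreal mult_nonneg_nonneg sum_nonneg) auto
    also have "\<dots> \<le> ennreal (Y A)"
    proof (rule ennreal_leI)
      have "(\<Sum>H\<in>\<H>. likelihood \<mu> H A * (\<Sum>H' | H' \<in> \<H> \<and> lam * m \<le> card (H' \<inter> H). \<kappa> H')) \<le>
          3 * \<delta> / 4 * ?Z + c * (\<Sum>H\<in>\<H>. likelihood \<mu> H A * ((\<Sum>H'\<in>near H. likelihood \<mu> H' A) / ?Z))"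
        unfolding c_def near_def by (rule kernel_overlap_le[OF \<kappa> lam \<delta> lam'])
      also have "\<dots> \<le> 3 * \<delta> / 4 * ?Z + c * (t * card \<H> + (\<Sum>H\<in>\<H>. likelihood \<mu> H A * W H A))"
      proof (intro add_left_mono mult_left_mono)
        show "(\<Sum>H\<in>\<H>. likelihood \<mu> H A * ((\<Sum>H'\<in>near H. likelihood \<mu> H' A) / ?Z)) \<le>
            t * card \<H> + (\<Sum>H\<in>\<H>. likelihood \<mu> H A * W H A)"
          using posterior_overlap_le[where \<mu> = \<mu> and t = t and C = C and lam = lam' and A = A] \<mu> t C
          by (simp add: near_def W_def w_def sum_divide_distrib)
      qed (use c in simp)
      also have "\<dots> = Y A"
        by (simp add: Y_def distrib_left sum_distrib_left)
      finally show "(\<Sum>H\<in>\<H>. likelihood \<mu> H A * (\<Sum>H' | H' \<in> \<H> \<and> lam * m \<le> card (H' \<inter> H). \<kappa> H')) \<le> Y A" .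
    qed
    finally show ?thesis .
  qed

  have w_sum: "(\<Sum>H'\<in>near H. w (card (H \<inter> H'))) \<le> (m + 1) * B / t" if H: "H \<in> \<H>" for H
  proof -
    have "(\<Sum>H' | H' \<in> \<H> \<and> lam' * m \<le> card (H \<inter> H'). w (card (H \<inter> H'))) \<le>
        card \<H> * ((m + 1) * (B / (t * card \<H>)))"
    proof (rule sum_overlap_le[OF H])
      fix l assume l: "lam' * m \<le> real l"
      \<comment> \<open>The gain l \<mu>^2 / 2 falls short of the sparsity cost l L by at least
        \<eta> l L, and here l is at least lam' m.\<close>
      have "l * (\<mu>\<^sup>2 / 2) \<le> l * ((1 - \<eta>) * L)"
        using \<mu>(2) by (intro mult_left_mono) auto
      moreover have "lam' * m * (\<eta> * L) \<le> l * (\<eta> * L)"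
        using l \<eta> L_nonneg by (intro mult_right_mono) auto
      ultimately have "real l * \<mu>\<^sup>2 / 2 + \<mu> * (C * m) + (x - l * L) \<le> x - lam' * m * \<eta> * L + \<mu> * (C * m)"
        by (simp add: algebra_simps)
      then have "exp (real l * \<mu>\<^sup>2 / 2 + \<mu> * (C * m)) * exp (x - l * L) \<le> B"
        unfolding B_def by (simp flip: exp_add)
      then show "w l * exp (x - l * L) \<le> B / (t * card \<H>)"
        using t by (simp add: w_def divide_right_mono)
    qed (use t in \<open>auto simp: w_def B_def\<close>)
    then show ?thesis
      using card_family_pos by (simp add: near_def)
  qed

  note lik = has_bochner_integral_likelihood[OF subgraph, of _ \<mu>]
  have pos: "0 < C * m" using C m_pos by simp
  have W_int: "integrable (null_law n) (\<lambda>A. likelihood \<mu> H A * W H A)" if H: "H \<in> \<H>" for H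
    unfolding W_def by (rule integral_deviation_plus_overlap(1)[OF H near_subset pos])
  have W_le: "(\<integral>A. likelihood \<mu> H A * W H A \<partial>null_law n) \<le> 1 / C + (m + 1) * B / t" if H: "H \<in> \<H>" for H
  proof -
    have "(\<integral>A. likelihood \<mu> H A * W H A \<partial>null_law n) \<le> m / (C * m) + (\<Sum>H'\<in>near H. w (card (H \<inter> H')))"
      unfolding W_def by (rule integral_deviation_plus_overlap(2)[OF H near_subset pos])
    also have "\<dots> \<le> 1 / C + (m + 1) * B / t"
      using w_sum[OF H] m_pos by simp
    finally show ?thesis .
  qed
  interpret N: prob_space "null_law n"
    by (intro prob_space_PiM prob_space_gaussian)
  have int1: "integrable (null_law n) (\<lambda>A. \<Sum>H\<in>\<H>. 3 * \<delta> / 4 * likelihood \<mu> H A)"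
    by (intro Bochner_Integration.integrable_sum integrable_mult_right impI) (auto intro: lik integrable.intros)
  have int2: "integrable (null_law n) (\<lambda>A. \<Sum>H\<in>\<H>. c * (likelihood \<mu> H A * W H A))"
    by (intro Bochner_Integration.integrable_sum integrable_mult_right impI W_int)
  have int3: "integrable (null_law n) (\<lambda>A. c * (t * card \<H>) + (\<Sum>H\<in>\<H>. c * (likelihood \<mu> H A * W H A)))"
    by (intro Bochner_Integration.integrable_add int2) simp
  have Y_int: "integrable (null_law n) Y"
    unfolding Y_def by (intro Bochner_Integration.integrable_add int1 int3)
  have "(\<integral>A. Y A \<partial>null_law n) =
      (\<integral>A. (\<Sum>H\<in>\<H>. 3 * \<delta> / 4 * likelihood \<mu> H A) \<partial>null_law n) +
      (c * (t * card \<H>) + (\<integral>A. (\<Sum>H\<in>\<H>. c * (likelihood \<mu> H A * W H A)) \<partial>null_law n))"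
    unfolding Y_def using int1 int2 int3
    by (simp add: Bochner_Integration.integral_add N.prob_space)
  also have "(\<integral>A. (\<Sum>H\<in>\<H>. 3 * \<delta> / 4 * likelihood \<mu> H A) \<partial>null_law n) = card \<H> * (3 * \<delta> / 4)"
    using lik by (subst Bochner_Integration.integral_sum) (auto simp: has_bochner_integral_iff)
  also have "(\<integral>A. (\<Sum>H\<in>\<H>. c * (likelihood \<mu> H A * W H A)) \<partial>null_law n) =
      (\<Sum>H\<in>\<H>. c * (\<integral>A. likelihood \<mu> H A * W H A \<partial>null_law n))"
    by (subst Bochner_Integration.integral_sum) (auto intro: W_int)
  also have "\<dots> \<le> (\<Sum>H\<in>\<H>. c * (1 / C + (m + 1) * B / t))"
    using W_le c by (intro sum_mono mult_left_mono) auto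
  also have "card \<H> * (3 * \<delta> / 4) + (c * (t * card \<H>) + (\<Sum>H\<in>\<H>. c * (1 / C + (m + 1) * B / t))) =
      card \<H> * (3 * \<delta> / 4 + (t + 1 / C + (m + 1) * B / t) / (2 * \<delta> * lam\<^sup>2))"
    by (simp add: c_def algebra_simps add_divide_distrib)
  finally have Y_le: "(\<integral>A. Y A \<partial>null_law n) \<le>
      card \<H> * (3 * \<delta> / 4 + (t + 1 / C + (m + 1) * B / t) / (2 * \<delta> * lam\<^sup>2))"
    by simp

  have meas: "(\<lambda>A. ennreal (likelihood \<mu> H A) * emeasure (K A) {H' \<in> \<H>. lam * m \<le> real (card (H' \<inter> H))})
      \<in> borel_measurable (null_law n)" if H: "H \<in> \<H>" for H
  proof (intro borel_measurable_times_ennreal)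
    show "(\<lambda>A. ennreal (likelihood \<mu> H A)) \<in> borel_measurable (null_law n)"
      using subgraph[OF H] by measurable
    show "(\<lambda>A. emeasure (K A) {H' \<in> \<H>. lam * m \<le> real (card (H' \<inter> H))}) \<in> borel_measurable (null_law n)"
      unfolding measurable_cong_sets[OF sets_null_law refl]
      by (rule measurable_compose[OF measurable_prob_algebraD[OF K'] measurable_emeasure_subprob_algebra]) auto
  qed
  \<comment> \<open>The sum moves inside the integral first, because the pointwise bound couples all
    hidden graphs through the posterior.\<close>
  have "(\<Sum>H\<in>\<H>. \<integral>\<^sup>+A. ennreal (likelihood \<mu> H A) *
        emeasure (K A) {H' \<in> \<H>. lam * m \<le> real (card (H' \<inter> H))} \<partial>null_law n) =
      (\<integral>\<^sup>+A. (\<Sum>H\<in>\<H>. ennreal (likelihood \<mu> H A) *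
        emeasure (K A) {H' \<in> \<H>. lam * m \<le> real (card (H' \<inter> H))}) \<partial>null_law n)"
    by (rule nn_integral_sum[symmetric]) (rule meas)
  also have "\<dots> \<le> (\<integral>\<^sup>+A. ennreal (Y A) \<partial>null_law n)"
    by (rule nn_integral_mono) (rule pointwise)
  also have "\<dots> = ennreal (\<integral>A. Y A \<partial>null_law n)"
    by (rule nn_integral_eq_integral[OF Y_int]) (simp add: Y_nonneg)
  also have "\<dots> \<le> ennreal (card \<H> * (3 * \<delta> / 4 + (t + 1 / C + (m + 1) * B / t) / (2 * \<delta> * lam\<^sup>2)))"
    by (rule ennreal_leI[OF Y_le])
  finally show ?thesis
    unfolding B_def using \<delta> t C
    by (intro estimation_prob_le[OF K]) (auto intro!: add_nonneg_nonneg divide_nonneg_nonneg mult_nonneg_nonneg)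
qed

end

section \<open>Uniformly sparse sequences\<close>

lemma ln_inverse_p1M:
  assumes "0 < card \<H>"
  shows "ln (1 / p1M \<H> m) = ln (card \<H>) / m"
  using assms by (simp add: p1M_def ln_div ln_powr)

text \<open>A maximum over finitely many extended reals is one of its terms, and no term is
  \<infinity>; since \<open>H1\<close> overlaps itself in m edges, some term is finite. So the
  excess is a real number, and exponentiating the inequality for each term gives the count.\<close>

lemma overlap_bounded_overlap_excess:
  assumes ne: "\<H> \<noteq> {}" and sub: "\<And>H. H \<in> \<H> \<Longrightarrow> H \<subseteq> complete_edges n \<and> card H = m" and m: "0 < m"
  shows "overlap_bounded n \<H> m (ln (1 / p1M \<H> m)) (real_of_ereal (overlap_excess \<H> m))"
proof -
  define L where "L = ln (1 / p1M \<H> m)"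
  define q where "q H l = \<P>(H2 in uniform_count_measure \<H>. card (H \<inter> H2) = l)" for H l
  define t where "t H l = ext_ln (q H l) + ereal (real l * L)" for H l
  have fin: "finite \<H>"
    by (rule finite_subset[of _ "Pow (complete_edges n)"]) (use sub in auto)
  then have card: "1 \<le> card \<H>"
    using ne by (simp add: Suc_le_eq card_gt_0_iff)
  have q: "q H l = card {H' \<in> \<H>. card (H \<inter> H') = l} / card \<H>" for H l
    unfolding q_def by (simp add: space_uniform_count_measure measure_uniform_count_measure[OF fin])
  have excess: "overlap_excess \<H> m = (MAX H\<in>\<H>. MAX l\<in>{0..m}. t H l)"
    by (simp add: overlap_excess_def t_def q_def L_def)
  have le: "t H l \<le> overlap_excess \<H> m" if "H \<in> \<H>" "l \<le> m" for H l
  proof -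
    have "t H l \<le> (MAX l\<in>{0..m}. t H l)" using that by (intro Max_ge) auto
    also have "\<dots> \<le> overlap_excess \<H> m" unfolding excess using that fin by (intro Max_ge) auto
    finally show ?thesis .
  qed
  have "overlap_excess \<H> m \<in> (\<lambda>H. MAX l\<in>{0..m}. t H l) ` \<H>"
    unfolding excess using fin ne by (intro Max_in) auto
  then obtain H where H: "overlap_excess \<H> m = (MAX l\<in>{0..m}. t H l)" by auto
  have "(MAX l\<in>{0..m}. t H l) \<in> t H ` {0..m}" by (intro Max_in) auto
  then obtain l where l: "(MAX l\<in>{0..m}. t H l) = t H l" by (rule imageE)
  have not_PInf: "overlap_excess \<H> m \<noteq> \<infinity>"
    unfolding H l by (simp add: t_def ext_ln_def)
  obtain H1 where H1: "H1 \<in> \<H>" using ne by auto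
  have "H1 \<in> {H' \<in> \<H>. card (H1 \<inter> H') = m}" using H1 sub by auto
  then have "q H1 m \<noteq> 0"
    using fin card unfolding q by (auto simp: card_eq_0_iff)
  then have "- \<infinity> < t H1 m" by (simp add: t_def ext_ln_def)
  also have "\<dots> \<le> overlap_excess \<H> m" by (rule le[OF H1]) simp
  finally have excess_real: "overlap_excess \<H> m = ereal (real_of_ereal (overlap_excess \<H> m))"
    using not_PInf by (intro ereal_real'[symmetric]) auto
  show ?thesis
    unfolding L_def[symmetric]
  proof
    show "0 \<le> L" using card by (simp add: L_def ln_inverse_p1M)
    fix H l assume H: "H \<in> \<H>" and l: "l \<le> m"
    show "real (card {H' \<in> \<H>. card (H \<inter> H') = l}) \<le>
        card \<H> * exp (real_of_ereal (overlap_excess \<H> m) - l * L)"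
    proof (cases "q H l = 0")
      case True
      then show ?thesis using card by (simp add: q)
    next
      case False
      then have pos: "0 < q H l" by (simp add: q)
      have "ereal (ln (q H l) + l * L) \<le> ereal (real_of_ereal (overlap_excess \<H> m))"
        using le[OF H l] False unfolding excess_real[symmetric] by (simp add: t_def ext_ln_def)
      then have "ln (q H l) \<le> real_of_ereal (overlap_excess \<H> m) - l * L" by simp
      then have "q H l \<le> exp (real_of_ereal (overlap_excess \<H> m) - l * L)"
        using pos by (metis exp_le_cancel_iff exp_ln)
      then show ?thesis using card by (simp add: q field_simps)
    qed
  qed (use ne sub m in auto)
qed

text \<open>Almost exact recovery asks for one vanishing sequence, while the estimates hold for each
  fixed \<open>d\<close>. For each \<open>n\<close> the finest level \<open>d k\<close>, with
  \<open>k \<le> n\<close>, that \<open>f\<close> already meets is selected; every level is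
  eventually met, so the selected levels vanish.\<close>

lemma diagonal_null_sequence:
  fixes f :: "real \<Rightarrow> nat \<Rightarrow> real"
  assumes lim: "\<And>d. 0 < d \<Longrightarrow> f d \<longlonglongrightarrow> 0"
  shows "\<exists>\<delta>. \<delta> \<longlonglongrightarrow> 0 \<and> (\<lambda>n. f (\<delta> n) n) \<longlonglongrightarrow> 0"
proof -
  define d where "d k = 1 / real (Suc k)" for k
  define S where "S n = {k. k \<le> n \<and> (k = 0 \<or> \<bar>f (d k) n\<bar> < d k)}" for n
  define \<kappa> where "\<kappa> n = Max (S n)" for n
  have S: "finite (S n)" "S n \<noteq> {}" for n
    by (auto simp: S_def)
  have \<kappa>_ge: "\<forall>\<^sub>F n in sequentially. k \<le> \<kappa> n" for k
  proof -
    have "\<forall>\<^sub>F n in sequentially. \<bar>f (d k) n\<bar> < d k"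
      using tendstoD[OF lim[of "d k"], of "d k"] by (simp add: d_def dist_real_def)
    with eventually_ge_at_top[of k] show ?thesis
      by eventually_elim (auto simp: \<kappa>_def S_def intro!: Max_ge)
  qed
  have \<kappa>: "filterlim \<kappa> at_top sequentially"
    unfolding filterlim_at_top by (simp add: \<kappa>_ge)
  have d: "(\<lambda>n. d (\<kappa> n)) \<longlonglongrightarrow> 0"
    using filterlim_compose[OF LIMSEQ_inverse_real_of_nat \<kappa>] by (simp add: d_def inverse_eq_divide)
  \<comment> \<open>Once the selected index is at least 1, the unconditional clause no longer
    applies.\<close>
  have "\<forall>\<^sub>F n in sequentially. norm (f (d (\<kappa> n)) n) \<le> d (\<kappa> n)"
    using \<kappa>_ge[of 1]
  proof eventually_elim
    case (elim n)
    have "\<kappa> n \<in> S n" unfolding \<kappa>_def using S by (rule Max_in)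
    then show ?case using elim by (auto simp: S_def)
  qed
  then have "(\<lambda>n. f (d (\<kappa> n)) n) \<longlonglongrightarrow> 0"
    using d by (rule Lim_null_comparison)
  with d show ?thesis by blast
qed

lemma filterlim_at_top_imp_exp_neg_tendsto:
  "filterlim (f :: nat \<Rightarrow> nat) at_top sequentially \<Longrightarrow> (\<lambda>n. exp (- real (f n))) \<longlonglongrightarrow> 0"
  by (intro filterlim_compose[OF exp_at_bot] filterlim_compose[OF filterlim_uminus_at_bot_at_top]
      filterlim_compose[OF filterlim_real_sequentially])

text \<open>Absorbs the m + 1 possible overlap values, since k + 1 is at most exp k.\<close>

lemma Suc_mult_exp_le:
  assumes "y \<le> - 2 * real k"
  shows "(real k + 1) * exp y \<le> exp (- real k)"
proof -
  have "(real k + 1) * exp y \<le> exp (real k) * exp (- 2 * real k)"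
    using assms exp_ge_add_one_self[of "real k"] by (intro mult_mono) (auto simp: add.commute)
  then show ?thesis by (simp flip: exp_add)
qed

theorem theorem6:
  fixes \<H> :: "nat \<Rightarrow> graph set"
    and m :: "nat \<Rightarrow> nat"
    and \<mu> :: "nat \<Rightarrow> real"
    and \<eta> :: real
  assumes nonempty: "\<And>n. n \<ge> 1 \<Longrightarrow> \<H> n \<noteq> {}"
    and subgraphs: "\<And>n H. n \<ge> 1 \<Longrightarrow> H \<in> \<H> n \<Longrightarrow> H \<subseteq> complete_edges n \<and> card H = m n"
    and m_unbounded: "filterlim m at_top sequentially"
    and sparse: "uniformly_sparse \<H> m"
    and mu_pos: "\<And>n. n \<ge> 1 \<Longrightarrow> \<mu> n > 0"
    and eta_pos: "\<eta> > 0"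
  shows
    "((\<forall>\<^sub>F n in sequentially.
         D_KL (gaussian (\<mu> n)) (gaussian 0) \<ge> (1 + \<eta>) * ln (1 / p1M (\<H> n) (m n))) \<longrightarrow>
      (\<forall>K. (\<forall>n\<ge>1. K n \<in> maximum_likelihood_estimators n (\<H> n) (gaussian (\<mu> n)) (gaussian 0)) \<longrightarrow>
         almost_exact_recovery \<H> m (\<lambda>n. gaussian (\<mu> n)) (\<lambda>n. gaussian 0) K)) \<and>
     ((\<forall>\<^sub>F n in sequentially.
         D_KL (gaussian (\<mu> n)) (gaussian 0) \<le> (1 - \<eta>) * ln (1 / p1M (\<H> n) (m n))) \<longrightarrow>
      (\<forall>lam\<in>{0<..<1}. \<forall>\<delta>\<in>{0<..<1}. \<forall>\<^sub>F n in sequentially.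
         \<forall>K \<in> estimators n (\<H> n).
           \<P>((Hs, Hh) in estimation_law n (\<H> n) (gaussian (\<mu> n)) (gaussian 0) K.
              real (card (Hh \<inter> Hs)) \<ge> lam * real (m n)) < \<delta>))"
proof -
  define L where "L n = ln (1 / p1M (\<H> n) (m n))" for n
  define x where "x n = real_of_ereal (overlap_excess (\<H> n) (m n))" for n
  have L_top: "filterlim L at_top sequentially"
    using sparse unfolding uniformly_sparse_def L_def[abs_def] by blast
  have m_ge: "\<forall>\<^sub>F n in sequentially. 0 < m n"
    using m_unbounded[unfolded filterlim_at_top, rule_format, of 1] by (simp add: Suc_le_eq)
  have L_ge: "\<forall>\<^sub>F n in sequentially. c \<le> L n" for c
    using L_top by (simp add: filterlim_at_top)
  have bounded: "overlap_bounded n (\<H> n) (m n) (L n) (x n)" if "1 \<le> n" "0 < m n" for n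
    unfolding L_def x_def using that nonempty subgraphs by (intro overlap_bounded_overlap_excess) auto
  have ln_card: "ln (card (\<H> n)) = m n * L n" and card: "card (\<H> n) = exp (m n * L n)"
    if "1 \<le> n" "0 < m n" for n
    using overlap_bounded.card_family_pos[OF bounded[OF that]] that by (simp_all add: L_def ln_inverse_p1M)
  \<comment> \<open>As log M = m L, the little-o of uniform sparsity becomes a comparison with an
    arbitrarily small fraction of m L.\<close>
  have x_le: "\<forall>\<^sub>F n in sequentially. x n \<le> \<epsilon> * (m n * L n)" if "0 < \<epsilon>" for \<epsilon>
  proof -
    have "\<forall>\<^sub>F n in sequentially. norm (x n) \<le> \<epsilon> * norm (ln (real (card (\<H> n))))"
      unfolding x_def by (rule landau_o.smallD[OF conjunct2[OF sparse[unfolded uniformly_sparse_def]] that])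
    with eventually_ge_at_top[of 1] m_ge L_ge[of 0] show ?thesis
      by eventually_elim (simp add: ln_card abs_mult)
  qed
  have exp_m: "(\<lambda>n. exp (- real (m n))) \<longlonglongrightarrow> 0"
    by (rule filterlim_at_top_imp_exp_neg_tendsto[OF m_unbounded])
  show ?thesis
  proof (intro conjI impI allI ballI)

    \<comment> \<open>Above the threshold: almost exact recovery\<close>
    fix K
    assume D: "\<forall>\<^sub>F n in sequentially.
        (1 + \<eta>) * ln (1 / p1M (\<H> n) (m n)) \<le> D_KL (gaussian (\<mu> n)) (gaussian 0)"
      and K: "\<forall>n\<ge>1. K n \<in> maximum_likelihood_estimators n (\<H> n) (gaussian (\<mu> n)) (gaussian 0)"
    define err where "err d n = \<P>((Hs, Hh) in estimation_law n (\<H> n) (gaussian (\<mu> n)) (gaussian 0) (K n).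
        real (card (Hh \<inter> Hs)) < (1 - d) * real (m n))" for d n
    \<comment> \<open>Solves (1 - 2 \<theta>) (1 + \<eta>) = 1 + \<eta> / 2, so half of the margin
      \<eta> survives the loss of \<theta>.\<close>
    define \<theta> where "\<theta> = \<eta> / (4 * (1 + \<eta>))"
    have \<theta>: "0 < \<theta>" "\<theta> < 1" using eta_pos by (simp_all add: \<theta>_def)
    have "1 + \<eta> / 2 = (1 - 2 * \<theta>) * (1 + \<eta>)"
      using eta_pos by (simp add: \<theta>_def field_simps)
    also have "\<dots> \<le> (1 - \<theta>)\<^sup>2 * (1 + \<eta>)"
      using eta_pos by (intro mult_right_mono) (auto simp: power2_diff)
    finally have \<eta>\<theta>: "1 + \<eta> / 2 \<le> (1 - \<theta>)\<^sup>2 * (1 + \<eta>)" .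
    have \<mu>: "\<forall>\<^sub>F n in sequentially. (1 + \<eta>) * L n \<le> (\<mu> n)\<^sup>2 / 2"
      using D by (simp add: D_KL_gaussian L_def)
    \<comment> \<open>The signal diverges with \<open>L\<close>, which makes the Markov term of
      order 1 / \<mu> vanish.\<close>
    have "\<forall>\<^sub>F n in sequentially. sqrt (L n) \<le> \<mu> n"
      using \<mu> L_ge[of 0] eventually_ge_at_top[of 1]
    proof eventually_elim
      case (elim n)
      have "0 \<le> \<eta> * L n" "0 \<le> L n" using eta_pos elim(2) by simp_all
      then have "L n \<le> (\<mu> n)\<^sup>2" using elim(1) by (simp add: distrib_right)
      then show ?case using mu_pos[OF elim(3)] by (intro real_le_lsqrt) auto
    qed
    then have \<mu>_top: "filterlim \<mu> at_top sequentially"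
      by (rule filterlim_at_top_mono[rotated]) (rule filterlim_compose[OF sqrt_at_top L_top])
    have err: "err d \<longlonglongrightarrow> 0" if d: "0 < d" for d
    proof (rule tendsto_sandwich)
      have d\<eta>: "0 < d * \<eta> / 4" using d eta_pos by simp
      show "\<forall>\<^sub>F n in sequentially. 0 \<le> err d n" by (simp add: err_def)
      show "\<forall>\<^sub>F n in sequentially. err d n \<le> 1 / (\<theta> * d) * inverse (\<mu> n) + exp (- real (m n))"
        \<comment> \<open>The slack uses up half of the gain d \<eta> m L / 2; the other half is at
          least 2 m once \<open>L\<close> is at least 8 / (d \<eta>).\<close>
        using \<mu> eventually_ge_at_top[of 1] m_ge x_le[OF d\<eta>] L_ge[of "8 / (d * \<eta>)"]
      proof eventually_elim
        case (elim n)
        interpret overlap_bounded n "\<H> n" "m n" "L n" "x n" by (rule bounded) fact+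
        have "err d n \<le> 1 / (\<theta> * d * \<mu> n) + (m n + 1) * exp (x n - d * m n * \<eta> * L n / 2)"
          unfolding err_def
          by (rule maximum_likelihood_overlap)
             (use elim K card mu_pos \<theta> eta_pos \<eta>\<theta> d in auto)
        also have "(m n + 1) * exp (x n - d * m n * \<eta> * L n / 2) \<le> exp (- real (m n))"
        proof -
          have "8 \<le> L n * (d * \<eta>)"
            using elim(5) d eta_pos by (simp add: pos_divide_le_eq)
          then have "real (m n) * 8 \<le> m n * (L n * (d * \<eta>))" by (intro mult_left_mono) auto
          moreover have "x n \<le> d * \<eta> / 4 * (m n * L n)"
            using elim(4) d eta_pos by simp
          ultimately have "x n - d * m n * \<eta> * L n / 2 \<le> - 2 * real (m n)"
            by (simp add: mult_ac)
          from Suc_mult_exp_le[OF this] show ?thesis by (simp add: add.commute)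
        qed
        finally show ?case by (simp add: field_simps)
      qed
      have "(\<lambda>n. 1 / (\<theta> * d) * inverse (\<mu> n) + exp (- real (m n))) \<longlonglongrightarrow> 1 / (\<theta> * d) * 0 + 0"
        by (intro tendsto_intros exp_m tendsto_inverse_0_at_top \<mu>_top)
      then show "(\<lambda>n. 1 / (\<theta> * d) * inverse (\<mu> n) + exp (- real (m n))) \<longlonglongrightarrow> 0" by simp
    qed simp
    show "almost_exact_recovery \<H> m (\<lambda>n. gaussian (\<mu> n)) (\<lambda>n. gaussian 0) K"
      using diagonal_null_sequence[of err, OF err] unfolding almost_exact_recovery_def err_def .
  next

    \<comment> \<open>Below the threshold: no estimator recovers a fixed fraction\<close>
    fix lam \<delta> :: real
    assume D: "\<forall>\<^sub>F n in sequentially.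
        D_KL (gaussian (\<mu> n)) (gaussian 0) \<le> (1 - \<eta>) * ln (1 / p1M (\<H> n) (m n))"
      and "lam \<in> {0<..<1}" "\<delta> \<in> {0<..<1}"
    then have lam: "0 < lam" and \<delta>: "0 < \<delta>" by auto
    define lam' where "lam' = \<delta>\<^sup>2 * lam\<^sup>2 / 2"
    \<comment> \<open>With \<open>C = 1 / t\<close>, the terms \<open>t\<close> and
      \<open>1 / C\<close> together contribute 2 t / (2 \<delta> lam^2) = \<delta> / 16.\<close>
    define t where "t = \<delta>\<^sup>2 * lam\<^sup>2 / 16"
    \<comment> \<open>A quarter of the gain rate: of the exponent lam' \<eta> m L = 4 a m L, the
      slack \<open>x\<close> and the deviation cost use at most a m L each, and the remaining half
      is at least 2 m.\<close>
    define a where "a = lam' * \<eta> / 4"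
    have pos: "0 < lam'" "0 < t" "0 < a"
      using lam \<delta> eta_pos by (simp_all add: lam'_def t_def a_def)
    have \<mu>: "\<forall>\<^sub>F n in sequentially. (\<mu> n)\<^sup>2 / 2 \<le> (1 - \<eta>) * L n"
      using D by (simp add: D_KL_gaussian L_def)
    have "(\<lambda>n. exp (- real (m n)) / (t * (2 * \<delta> * lam\<^sup>2))) \<longlonglongrightarrow> 0"
      using tendsto_divide[OF exp_m tendsto_const[of "t * (2 * \<delta> * lam\<^sup>2)"]] pos lam \<delta> by simp
    then have small: "\<forall>\<^sub>F n in sequentially. exp (- real (m n)) / (t * (2 * \<delta> * lam\<^sup>2)) < \<delta> / 16"
      using \<delta> by (intro order_tendstoD(2)) auto
    show "\<forall>\<^sub>F n in sequentially. \<forall>K \<in> estimators n (\<H> n).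
        \<P>((Hs, Hh) in estimation_law n (\<H> n) (gaussian (\<mu> n)) (gaussian 0) K.
          lam * real (m n) \<le> real (card (Hh \<inter> Hs))) < \<delta>"
      using \<mu> small eventually_ge_at_top[of 1] m_ge x_le[OF pos(3)]
        L_ge[of "1 / a"] L_ge[of "2 * (1 / (t * a))\<^sup>2"] L_ge[of 0]
    \<comment> \<open>All thresholds on \<open>n\<close> are fixed before \<open>K\<close> is
      introduced, so they serve every estimator at once.\<close>
    proof (eventually_elim, intro ballI)
      fix n K
      assume \<mu>n: "(\<mu> n)\<^sup>2 / 2 \<le> (1 - \<eta>) * L n"
        and small: "exp (- real (m n)) / (t * (2 * \<delta> * lam\<^sup>2)) < \<delta> / 16"
        and n: "1 \<le> n" "0 < m n" and xn: "x n \<le> a * (m n * L n)"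
        and L: "1 / a \<le> L n" "2 * (1 / (t * a))\<^sup>2 \<le> L n" "0 \<le> L n"
        and K: "K \<in> estimators n (\<H> n)"
      interpret overlap_bounded n "\<H> n" "m n" "L n" "x n" by (rule bounded[OF n])
      \<comment> \<open>Here \<mu> is at most sqrt(2 L), hence \<mu> / t is o(L); the lower bound 2
        (1 / (t a))^2 on \<open>L\<close> makes this quantitative.\<close>
      have \<mu>_le: "\<mu> n * (1 / t) \<le> a * L n"
      proof (rule power2_le_imp_le)
        have "0 \<le> \<eta> * L n" using eta_pos L(3) by simp
        then have "(\<mu> n)\<^sup>2 \<le> 2 * L n"
          using \<mu>n unfolding left_diff_distrib by linarith
        then have "(\<mu> n * (1 / t))\<^sup>2 \<le> 2 * L n * (1 / t)\<^sup>2"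
          unfolding power_mult_distrib by (intro mult_right_mono) auto
        also have "\<dots> = 2 * (1 / (t * a))\<^sup>2 * (a\<^sup>2 * L n)"
          using pos by (simp add: field_simps power2_eq_square)
        also have "\<dots> \<le> L n * (a\<^sup>2 * L n)"
          using L by (intro mult_right_mono) auto
        also have "\<dots> = (a * L n)\<^sup>2" by (simp add: power2_eq_square mult_ac)
        finally show "(\<mu> n * (1 / t))\<^sup>2 \<le> (a * L n)\<^sup>2" .
        show "0 \<le> a * L n" using pos L(3) by simp
      qed
      have "\<P>((Hs, Hh) in estimation_law n (\<H> n) (gaussian (\<mu> n)) (gaussian 0) K.
          lam * real (m n) \<le> real (card (Hh \<inter> Hs))) \<le>
          3 * \<delta> / 4 + (t + 1 / (1 / t) +
            (m n + 1) * exp (x n - lam' * m n * \<eta> * L n + \<mu> n * (1 / t * m n)) / t) / (2 * \<delta> * lam\<^sup>2)"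
        by (rule estimator_overlap[OF K]) (use mu_pos n \<mu>n eta_pos pos lam \<delta> lam'_def in auto)
      also have "\<dots> \<le> 3 * \<delta> / 4 + (t + t + exp (- real (m n)) / t) / (2 * \<delta> * lam\<^sup>2)"
      proof -
        have "\<mu> n * (1 / t * m n) \<le> a * (m n * L n)"
          using mult_right_mono[OF \<mu>_le, of "m n"] by (simp add: mult_ac)
        moreover have "1 \<le> L n * a" using L(1) pos by (simp add: pos_divide_le_eq)
        then have "real (m n) \<le> a * (m n * L n)"
          using mult_right_mono[of 1 "L n * a" "m n"] by (simp add: mult_ac)
        moreover have "lam' * m n * \<eta> * L n = 4 * (a * (m n * L n))"
          by (simp add: a_def)
        ultimately have "x n - lam' * m n * \<eta> * L n + \<mu> n * (1 / t * m n) \<le> - 2 * real (m n)"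
          using xn by linarith
        from Suc_mult_exp_le[OF this]
        have "(m n + 1) * exp (x n - lam' * m n * \<eta> * L n + \<mu> n * (1 / t * m n)) \<le> exp (- real (m n))"
          by (simp add: add.commute)
        then show ?thesis
          using pos lam \<delta> by (intro add_left_mono divide_right_mono add_mono) auto
      qed
      also have "\<dots> = 3 * \<delta> / 4 + \<delta> / 16 + exp (- real (m n)) / (t * (2 * \<delta> * lam\<^sup>2))"
        using lam \<delta> by (simp add: add_divide_distrib) (simp add: t_def field_simps power2_eq_square)
      \<comment> \<open>The total stays below (3/4 + 1/16 + 1/16) \<delta>.\<close>
      also have "\<dots> < \<delta>" using small \<delta> by linarith
      finally show "\<P>((Hs, Hh) in estimation_law n (\<H> n) (gaussian (\<mu> n)) (gaussian 0) K.
          lam * real (m n) \<le> real (card (Hh \<inter> Hs))) < \<delta>" .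
    qed
  qed
qed

end
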